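(* Let $\delta\in(0,1/2)$. Any randomized algorithm in the weak-oracle model that outputs a constant-factor approximate solution for the $k$-median problem on $n$ points with probability at least $3/4$ must make $\Omega\big(\frac{nk}{(1-2\delta)^2}\big)$ weak-oracle queries in expectation.
   Context: Weak-oracle model: the input is a set $X$ of $n$ points in a metric space $(\mathcal{X},d)$ and an integer $k$; the algorithm may only query a weak oracle which, for any pair $x,y$, returns $d(x,y)$ with probability $1-\delta$ and an arbitrary value with probability $\delta$, independently across pairs, with persistent answers. The $k$-median problem asks for $k$ centers $C$ minimizing $\sum_{x\in X}\min_{c\in C}d(x,c)$.
   Formalization: The bound is stated for 2 ≤ k < n: for k = 1 a uniformly random point is an 8-approximation with probability at least 3/4 using no queries, and for k = n outputting all points needs no queries, so the claim fails there. *)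

theory Defs
  imports "HOL-Analysis.Analysis" "HOL-Probability.Probability"
begin

definition kmedian_cost :: "('p \<Rightarrow> 'p \<Rightarrow> real) \<Rightarrow> 'p set \<Rightarrow> 'p set \<Rightarrow> real" where
  "kmedian_cost d X C = (\<Sum>x\<in>X. MIN c\<in>C. d x c)"

definition kmedian_opt :: "('p \<Rightarrow> 'p \<Rightarrow> real) \<Rightarrow> 'p set \<Rightarrow> nat \<Rightarrow> real" where
  "kmedian_opt d X k = (MIN C \<in> {C. C \<subseteq> X \<and> card C = k}. kmedian_cost d X C)"

definition approx_kmedian ::
  "real \<Rightarrow> ('p \<Rightarrow> 'p \<Rightarrow> real) \<Rightarrow> 'p set \<Rightarrow> nat \<Rightarrow> 'p set \<Rightarrow> bool" where
  "approx_kmedian c d X k C \<longleftrightarrow>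
     C \<subseteq> X \<and> card C = k \<and> kmedian_cost d X C \<le> c * kmedian_opt d X k"

(* The oracle's randomness N is drawn once, before any query: N {x,y} says that the answer for
   the unordered pair {x,y} is corrupted.  Since the answer is then a function of N and the pair,
   answers are persistent, symmetric, and independent across pairs. *)
definition corruption_pmf :: "'p set \<Rightarrow> real \<Rightarrow> ('p set \<Rightarrow> bool) pmf" where
  "corruption_pmf X \<delta> =
     Pi_pmf {{x, y} | x y. x \<in> X \<and> y \<in> X \<and> x \<noteq> y} False (\<lambda>_. bernoulli_pmf \<delta>)"

(* g gives the arbitrary values returned on corrupted pairs. *)
definition weak_oracle ::
  "('p \<Rightarrow> 'p \<Rightarrow> real) \<Rightarrow> ('p set \<Rightarrow> real) \<Rightarrow> ('p set \<Rightarrow> bool) \<Rightarrow> 'p \<Rightarrow> 'p \<Rightarrow> real" where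
  "weak_oracle d g N x y = (if N {x, y} then g {x, y} else d x y)"

datatype 'p action = Query 'p 'p | Output "'p set"

definition legal_actions :: "'p set \<Rightarrow> 'p action set" where
  "legal_actions X =
     {Query x y | x y. x \<in> X \<and> y \<in> X \<and> x \<noteq> y} \<union> {Output C | C. C \<subseteq> X}"

(* A deterministic strategy chooses the next action from the list of answers received so far
   (the past queries are determined by that list).  It may fail to halt. *)
type_synonym 'p strategy = "real list \<Rightarrow> 'p action"

type_synonym tape = "nat \<Rightarrow> bool"

(* A randomized algorithm is a random strategy: the random tape is drawn from an arbitrary
   probability space and selects the strategy. *)
definition randomized_algorithm ::
  "'p set \<Rightarrow> tape measure \<Rightarrow> (tape \<Rightarrow> 'p strategy) \<Rightarrow> bool" where
  "randomized_algorithm X M A \<longleftrightarrow>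
     prob_space M \<and> (\<forall>h. (\<lambda>\<omega>. A \<omega> h) \<in> M \<rightarrow>\<^sub>M count_space (legal_actions X))"

(* Answers received after at most t queries to the oracle w; the list stays constant once the
   strategy has produced its output. *)
primrec answers :: "('p \<Rightarrow> 'p \<Rightarrow> real) \<Rightarrow> 'p strategy \<Rightarrow> nat \<Rightarrow> real list" where
  "answers w S 0 = []"
| "answers w S (Suc t) =
     (case S (answers w S t) of
        Query x y \<Rightarrow> answers w S t @ [w x y]
      | Output C \<Rightarrow> answers w S t)"

definition outputs :: "('p \<Rightarrow> 'p \<Rightarrow> real) \<Rightarrow> 'p strategy \<Rightarrow> 'p set \<Rightarrow> bool" where
  "outputs w S C \<longleftrightarrow> (\<exists>t. S (answers w S t) = Output C)"

(* Infinite if the strategy does not halt; repeated queries are counted each time. *)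
definition num_queries :: "('p \<Rightarrow> 'p \<Rightarrow> real) \<Rightarrow> 'p strategy \<Rightarrow> ennreal" where
  "num_queries w S = (SUP t. of_nat (length (answers w S t)))"

(* The tape and the oracle's corruptions are independent, so probabilities and expectations are
   taken over the tape first and then over the corruptions. *)
definition success_prob ::
  "real \<Rightarrow> 'p set \<Rightarrow> nat \<Rightarrow> real \<Rightarrow> ('p \<Rightarrow> 'p \<Rightarrow> real) \<Rightarrow> ('p set \<Rightarrow> real) \<Rightarrow>
   tape measure \<Rightarrow> (tape \<Rightarrow> 'p strategy) \<Rightarrow> real" where
  "success_prob c X k \<delta> d g M A =
     measure_pmf.expectation (corruption_pmf X \<delta>)
       (\<lambda>N. \<P>(\<omega> in M. \<exists>C. outputs (weak_oracle d g N) (A \<omega>) C \<and> approx_kmedian c d X k C))"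

definition expected_queries ::
  "'p set \<Rightarrow> real \<Rightarrow> ('p \<Rightarrow> 'p \<Rightarrow> real) \<Rightarrow> ('p set \<Rightarrow> real) \<Rightarrow>
   tape measure \<Rightarrow> (tape \<Rightarrow> 'p strategy) \<Rightarrow> ennreal" where
  "expected_queries X \<delta> d g M A =
     (\<integral>\<^sup>+N. (\<integral>\<^sup>+\<omega>. num_queries (weak_oracle d g N) (A \<omega>) \<partial>M) \<partial>measure_pmf (corruption_pmf X \<delta>))"

end

theory Submission
  imports Defs
begin

text \<open>
  Inputs are clusterings of the points into \<open>k\<close> clusters, with a tiny distance inside a cluster and
  distance 1 across; then a constant-factor solution must hit every cluster. With the
  adversary returning the wrong distance on corrupted pairs, an answer is a bit that is flipped with
  probability \<open>\<delta>\<close>, so telling two worlds apart takes of the order of \<open>1 / (1 - 2 * \<delta>)\<^sup>2\<close> queries to the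
  pairs on which they differ.

  If \<open>n \<le> 8 * k\<close>, one pair among \<open>k + 1\<close> known groups is merged, and one of its two groups has to be left
  without a centre. The sets of pairs on which the merged worlds differ from the unmerged one are
  disjoint, and there are about \<open>k\<^sup>2 / 2\<close> of them.

  If \<open>n > 8 * k\<close>, there are \<open>k - 1\<close> clusters with uniformly random labels and one hidden outlier. To rule
  out that a given ordinary point is the outlier, its cluster has to be found, which takes
  of the order of \<open>k / (1 - 2 * \<delta>)\<^sup>2\<close> queries per point.

  Both bounds are inequalities for deterministic strategies, linear in the success probability and in
  the expected number of queries, and therefore survive averaging over the random tape.
\<close>

section \<open>Distinguishing two noisy worlds\<close>

text \<open>The Bhattacharyya coefficient of two Bernoulli distributions.\<close>

definition affinity :: "real \<Rightarrow> real \<Rightarrow> real" where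
  "affinity A B = sqrt (A * B) + sqrt ((1 - A) * (1 - B))"

text \<open>Cauchy-Schwarz for the vectors of square roots; the cross term is bounded by
  AM-GM.\<close>

lemma sqrt_mult_add_le:
  fixes x1 x2 y1 y2 :: real
  assumes "0 \<le> x1" "0 \<le> x2" "0 \<le> y1" "0 \<le> y2"
  shows "sqrt (x1 * y1) + sqrt (x2 * y2) \<le> sqrt ((x1 + x2) * (y1 + y2))"
proof (rule real_le_rsqrt)
  have "2 * sqrt ((x1 * y2) * (x2 * y1)) \<le> x1 * y2 + x2 * y1"
    using arith_geo_mean_sqrt[of "x1 * y2" "x2 * y1"] assms by simp
  moreover have "sqrt (x1 * y1) * sqrt (x2 * y2) = sqrt ((x1 * y2) * (x2 * y1))"
    by (simp add: real_sqrt_mult[symmetric] mult_ac)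
  ultimately show "(sqrt (x1 * y1) + sqrt (x2 * y2))\<^sup>2 \<le> (x1 + x2) * (y1 + y2)"
    using assms by (simp add: power2_sum algebra_simps)
qed

text \<open>Cauchy-Schwarz, once for the event and once for its complement. Think of
  \<open>p\<close> and \<open>q\<close> as the laws of the next answer in two worlds and of
  \<open>A1\<close>, \<open>A2\<close>, \<open>B1\<close>, \<open>B2\<close> as the conditional
  probabilities after it; this is one step of a run.\<close>

lemma affinity_mixture:
  assumes "p \<in> {0..1}" "q \<in> {0..1}" "A1 \<in> {0..1}" "A2 \<in> {0..1}" "B1 \<in> {0..1}" "B2 \<in> {0..1}"
  shows "sqrt (p * q) * affinity A1 B1 + sqrt ((1 - p) * (1 - q)) * affinity A2 B2
    \<le> affinity (p * A1 + (1 - p) * A2) (q * B1 + (1 - q) * B2)"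
proof -
  have "sqrt ((p * A1) * (q * B1)) + sqrt (((1 - p) * A2) * ((1 - q) * B2))
      \<le> sqrt ((p * A1 + (1 - p) * A2) * (q * B1 + (1 - q) * B2))"
    using assms by (intro sqrt_mult_add_le) auto
  moreover have "sqrt ((p * (1 - A1)) * (q * (1 - B1))) + sqrt (((1 - p) * (1 - A2)) * ((1 - q) * (1 - B2)))
      \<le> sqrt ((p * (1 - A1) + (1 - p) * (1 - A2)) * (q * (1 - B1) + (1 - q) * (1 - B2)))"
    using assms by (intro sqrt_mult_add_le) auto
  moreover have compl: "r * (1 - A) + (1 - r) * (1 - B) = 1 - (r * A + (1 - r) * B)" for r A B :: real
    by algebra
  moreover have mult: "sqrt (r * t) * sqrt (A * B) = sqrt ((r * A) * (t * B))" for r t A B :: real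
    by (simp add: real_sqrt_mult)
  ultimately show ?thesis
    unfolding affinity_def distrib_left mult compl by linarith
qed

text \<open>Le Cam's bound of total variation by affinity: the right side equals
  \<open>(X - Y)\<^sup>2\<close>, while \<open>A - B = (X - Y) * (X + Y)\<close> and AM-GM gives
  \<open>X + Y \<le> 1\<close>.\<close>

lemma diff_le_affinity:
  assumes "A \<in> {0..1}" "B \<in> {0..1}"
  shows "(A - B)\<^sup>2 \<le> 1 - (affinity A B)\<^sup>2"
proof -
  define X Y where "X = sqrt (A * (1 - B))" and "Y = sqrt (B * (1 - A))"
  have sq: "X\<^sup>2 = A * (1 - B)" "Y\<^sup>2 = B * (1 - A)"
    using assms by (auto simp: X_def Y_def)
  have "sqrt (A * B) * sqrt ((1 - A) * (1 - B)) = X * Y"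
    by (simp add: X_def Y_def real_sqrt_mult[symmetric] mult_ac)
  moreover have "(sqrt (A * B))\<^sup>2 = A * B" "(sqrt ((1 - A) * (1 - B)))\<^sup>2 = (1 - A) * (1 - B)"
    using assms by auto
  ultimately have aff: "1 - (affinity A B)\<^sup>2 = (X - Y)\<^sup>2"
    unfolding affinity_def power2_sum power2_diff sq by (simp add: algebra_simps)
  have "X \<le> (A + (1 - B)) / 2" "Y \<le> (B + (1 - A)) / 2"
    using assms unfolding X_def Y_def by (intro arith_geo_mean_sqrt; simp)+
  moreover have "0 \<le> X" "0 \<le> Y"
    using assms by (auto simp: X_def Y_def)
  ultimately have "(X + Y)\<^sup>2 \<le> 1"
    by (intro power_le_one) auto
  have "A - B = X\<^sup>2 - Y\<^sup>2"
    unfolding sq by (simp add: algebra_simps)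
  also have "\<dots> = (X - Y) * (X + Y)"
    by (simp add: power2_eq_square algebra_simps)
  finally have "(A - B)\<^sup>2 = (X - Y)\<^sup>2 * (X + Y)\<^sup>2"
    by (simp add: power_mult_distrib)
  also have "\<dots> \<le> (X - Y)\<^sup>2"
    using \<open>(X + Y)\<^sup>2 \<le> 1\<close> by (simp add: mult_left_le)
  finally show ?thesis
    using aff by simp
qed

text \<open>A query strategy on bits: the history lists the answers, and stopping is \<^const>\<open>None\<close>.\<close>

primrec run :: "(bool list \<Rightarrow> 'e option) \<Rightarrow> ('e \<Rightarrow> bool) \<Rightarrow> nat \<Rightarrow> bool list \<Rightarrow> bool list" where
  "run q a 0 h = h"
| "run q a (Suc r) h = (case q h of None \<Rightarrow> h | Some e \<Rightarrow> run q a r (h @ [a e]))"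

text \<open>The strategy is deterministic, so the history determines the past queries:
  \<open>q (take i h)\<close> preceded answer \<open>i\<close>. Repetitions count.\<close>

definition cnt :: "(bool list \<Rightarrow> 'e option) \<Rightarrow> 'e set \<Rightarrow> bool list \<Rightarrow> nat" where
  "cnt q D h = (\<Sum>i<length h. of_bool (q (take i h) \<in> Some ` D))"

lemma cnt_Nil [simp]: "cnt q D [] = 0"
  by (simp add: cnt_def)

lemma cnt_snoc: "cnt q D (h @ [v]) = cnt q D h + of_bool (q h \<in> Some ` D)"
  by (simp add: cnt_def)

lemma length_run: "length (run q a r h) \<le> length h + r"
proof (induction r arbitrary: h)
  case (Suc r)
  have "length (run q a r (h @ [v])) \<le> length h + Suc r" for v
    using Suc.IH[of "h @ [v]"] by simp
  then show ?case
    by (auto split: option.splits)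
qed simp

lemma cnt_run_mono: "cnt q D h \<le> cnt q D (run q a r h)"
proof (induction r arbitrary: h)
  case (Suc r)
  show ?case
  proof (cases "q h")
    case (Some e)
    have "cnt q D h \<le> cnt q D (h @ [a e])"
      by (simp add: cnt_snoc)
    also have "\<dots> \<le> cnt q D (run q a r (h @ [a e]))"
      by (rule Suc.IH)
    finally show ?thesis
      using Some by simp
  qed simp
qed simp

text \<open>The definition of \<open>run\<close> peels off the first step; arguments that go forward
  in time need the last one.\<close>

lemma run_Suc: "run q a (Suc r) h =
    (case q (run q a r h) of None \<Rightarrow> run q a r h | Some e \<Rightarrow> run q a r h @ [a e])"
proof (induction r arbitrary: h)
  case (Suc r)
  show ?case
  proof (cases "q h")
    case (Some e)
    have unfold: "run q a (Suc i) h = run q a i (h @ [a e])" for i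
      using Some by simp
    show ?thesis
      unfolding unfold by (rule Suc.IH)
  qed simp
qed (auto split: option.splits)

lemma cnt_mono: "D \<subseteq> D' \<Longrightarrow> cnt q D h \<le> cnt q D' h"
  unfolding cnt_def by (intro sum_mono) auto

text \<open>Disjointness lets each query count for at most one \<open>j\<close>.\<close>

lemma sum_cnt_le:
  assumes "finite J" "disjoint_family_on D J"
  shows "(\<Sum>j\<in>J. cnt q (D j) h) \<le> cnt q (\<Union>j\<in>J. D j) h"
proof -
  have "(\<Sum>j\<in>J. of_bool (z \<in> Some ` D j)) \<le> (of_bool (z \<in> Some ` (\<Union>j\<in>J. D j)) :: nat)" for z
  proof (cases "\<exists>j\<in>J. z \<in> Some ` D j")
    case True
    then obtain j where j: "j \<in> J" "z \<in> Some ` D j" by auto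
    have "(\<Sum>i\<in>J. of_bool (z \<in> Some ` D i)) = (\<Sum>i\<in>J. of_bool (i = j) :: nat)"
      using j assms(2) by (intro sum.cong) (auto simp: disjoint_family_on_def)
    then show ?thesis
      using j assms(1) by auto
  qed auto
  then show ?thesis
    unfolding cnt_def by (subst sum.swap) (intro sum_mono)
qed

lemma cnt_le_length: "cnt q D h \<le> length h"
  unfolding cnt_def by (rule order.trans[OF sum_mono[where g = "\<lambda>_. 1"]]) auto

section \<open>Worlds observed through independent bit flips\<close>

locale noisy_bits =
  fixes E :: "'e set" and \<delta> :: real
  assumes finite_E: "finite E" and \<delta>_pos: "0 < \<delta>" and \<delta>_less: "\<delta> < 1/2"
begin

abbreviation noise :: "('e \<Rightarrow> bool) pmf" where
  "noise \<equiv> Pi_pmf E False (\<lambda>_. bernoulli_pmf \<delta>)"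

text \<open>\<open>\<theta>\<close> is the world of true bits, and \<open>P\<close> sees them xor
  the noise. All answers are drawn in advance, so the same strategy can be compared in different
  worlds.\<close>

definition pr :: "('e \<Rightarrow> bool) \<Rightarrow> (('e \<Rightarrow> bool) \<Rightarrow> bool) \<Rightarrow> real" where
  "pr \<theta> P = measure_pmf.prob noise {N. P (\<lambda>e. \<theta> e \<noteq> N e)}"

lemma pr_in_01: "pr \<theta> P \<in> {0..1}"
  by (simp add: pr_def)

lemma noise_resample:
  assumes "e \<in> E"
  shows "noise = bind_pmf (bernoulli_pmf \<delta>) (\<lambda>y. map_pmf (\<lambda>f. f(e := y)) noise)"
proof -
  have E: "E = insert e (E - {e})" and fin: "finite (E - {e})"
    using assms finite_E by auto
  define P where "P = Pi_pmf (E - {e}) False (\<lambda>_. bernoulli_pmf \<delta>)"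
  have ins: "noise = bind_pmf (bernoulli_pmf \<delta>) (\<lambda>y. bind_pmf P (\<lambda>f. return_pmf (f(e := y))))"
    unfolding P_def by (subst E, subst Pi_pmf_insert') (use fin in auto)
  have "map_pmf (\<lambda>f. f(e := y)) noise = bind_pmf P (\<lambda>f. return_pmf (f(e := y)))" for y
    unfolding ins by (simp add: map_bind_pmf)
  then show ?thesis
    using ins by simp
qed

text \<open>Conditions on the observed answer at \<open>e\<close>; by \<open>noise_resample\<close>
  this coordinate can be redrawn independently of the others.\<close>

lemma pr_split:
  assumes "e \<in> E"
  shows "pr \<theta> P = (if \<theta> e then 1 - \<delta> else \<delta>) * pr \<theta> (\<lambda>a. P (a(e := True)))
     + (if \<theta> e then \<delta> else 1 - \<delta>) * pr \<theta> (\<lambda>a. P (a(e := False)))"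
proof -
  have upd: "(\<lambda>e'. \<theta> e' = (\<not> (N(e := y)) e')) = (\<lambda>e'. \<theta> e' = (\<not> N e'))(e := (\<theta> e = (\<not> y)))" for N y
    by (auto simp: fun_eq_iff)
  have "pr \<theta> P = measure_pmf.prob (bind_pmf (bernoulli_pmf \<delta>) (\<lambda>y. map_pmf (\<lambda>f. f(e := y)) noise))
      {N. P (\<lambda>e. \<theta> e \<noteq> N e)}"
    unfolding pr_def using noise_resample[OF assms] by simp
  also have "\<dots> = \<delta> * pr \<theta> (\<lambda>a. P (a(e := (\<theta> e \<noteq> True)))) + (1 - \<delta>) * pr \<theta> (\<lambda>a. P (a(e := (\<theta> e \<noteq> False))))"
    (is "measure_pmf.prob ?M ?S = ?r")
  proof -
    have "emeasure ?M ?S = ennreal ?r"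
      using \<delta>_pos \<delta>_less unfolding emeasure_bind_pmf
      by (subst nn_integral_bernoulli_pmf)
        (simp_all add: vimage_def upd pr_def measure_pmf.emeasure_eq_measure mult.commute
          flip: ennreal_mult ennreal_plus del: fun_upd_apply)
    moreover have "0 \<le> ?r"
      using \<delta>_pos \<delta>_less by (simp add: pr_def)
    ultimately show ?thesis
      unfolding measure_pmf.emeasure_eq_measure by (subst (asm) ennreal_inj) auto
  qed
  finally show ?thesis
    by simp
qed

lemma pr_const: "pr \<theta> (\<lambda>_. P) = of_bool P"
  by (simp add: pr_def)

lemma pr_mono: "(\<And>a. P a \<Longrightarrow> Q a) \<Longrightarrow> pr \<theta> P \<le> pr \<theta> Q"
  unfolding pr_def by (intro measure_pmf.finite_measure_mono) auto

lemma pr_disj_le: "pr \<theta> (\<lambda>a. P a \<or> Q a) \<le> pr \<theta> P + pr \<theta> Q"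
  unfolding pr_def Collect_disj_eq by (rule measure_Un_le) auto

lemma pr_not: "pr \<theta> (\<lambda>a. \<not> P a) = 1 - pr \<theta> P"
  using measure_pmf.prob_compl[of "{N. P (\<lambda>e. \<theta> e \<noteq> N e)}" noise]
  by (simp add: pr_def Compl_eq_Diff_UNIV[symmetric] Collect_neg_eq)

lemma pr_conv_expectation:
  "pr \<theta> P = measure_pmf.expectation noise (\<lambda>N. of_bool (P (\<lambda>e. \<theta> e \<noteq> N e)))"
proof -
  have "(\<lambda>N. of_bool (P (\<lambda>e. \<theta> e \<noteq> N e)) :: real) = indicator {N. P (\<lambda>e. \<theta> e \<noteq> N e)}"
    by (auto simp: fun_eq_iff indicator_def)
  then show ?thesis
    unfolding pr_def by simp
qed

text \<open>Linearity of expectation: it suffices to bound, for each outcome, how many of the events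
  hold.\<close>

lemma sum_pr_le:
  fixes B :: real
  assumes "\<And>a. (\<Sum>i\<in>I. of_bool (P i a)) \<le> B"
  shows "(\<Sum>i\<in>I. pr \<theta> (P i)) \<le> B"
proof -
  have fin: "finite (set_pmf noise)"
    using finite_E by (auto simp: set_Pi_pmf)
  have "(\<Sum>i\<in>I. pr \<theta> (P i)) = measure_pmf.expectation noise (\<lambda>N. \<Sum>i\<in>I. of_bool (P i (\<lambda>e. \<theta> e \<noteq> N e)))"
    unfolding pr_conv_expectation
    by (rule Bochner_Integration.integral_sum[symmetric]) (rule integrable_measure_pmf_finite[OF fin])
  also have "\<dots> \<le> measure_pmf.expectation noise (\<lambda>_. B)"
    by (intro integral_mono integrable_measure_pmf_finite[OF fin] assms)
  finally show ?thesis
    by simp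
qed

text \<open>Answers already revealed are fixed by a partial map, so that repeated queries, which return the
  same bit again, need no separate treatment in the induction over the run.\<close>

definition override :: "('e \<Rightarrow> bool option) \<Rightarrow> ('e \<Rightarrow> bool) \<Rightarrow> 'e \<Rightarrow> bool" where
  "override \<kappa> a e = (case \<kappa> e of None \<Rightarrow> a e | Some v \<Rightarrow> v)"

lemma override_upd: "\<kappa> e = None \<Longrightarrow> override \<kappa> (a(e := v)) = override (\<kappa>(e \<mapsto> v)) a"
  by (auto simp: override_def fun_eq_iff split: option.splits)

text \<open>Induction on the remaining steps. A fresh query on which the worlds differ costs a
  factor \<open>2 * sqrt (\<delta> * (1 - \<delta>))\<close>, the affinity of the two laws of the
  answer; other queries cost nothing. Putting the budget \<open>b\<close> into the event bounds the
  number of factors.\<close>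

lemma affinity_run:
  fixes q :: "bool list \<Rightarrow> 'e option" and \<Phi> :: "bool list \<Rightarrow> bool" and b :: nat
  assumes q: "\<And>h e. q h = Some e \<Longrightarrow> e \<in> E"
    and D: "\<And>e. e \<in> E - D \<Longrightarrow> \<theta> e = \<theta>' e"
  defines "P \<equiv> \<lambda>\<kappa> r h a. cnt q D (run q (override \<kappa> a) r h) \<le> b \<and> \<Phi> (run q (override \<kappa> a) r h)"
  shows "(2 * sqrt (\<delta> * (1 - \<delta>))) ^ (b - cnt q D h)
    \<le> affinity (pr \<theta> (P \<kappa> r h)) (pr \<theta>' (P \<kappa> r h))"
proof (induction r arbitrary: h \<kappa>)
  let ?\<rho> = "2 * sqrt (\<delta> * (1 - \<delta>))"
  have \<rho>0: "0 \<le> ?\<rho>"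
    using \<delta>_pos \<delta>_less by auto
  have \<rho>1: "?\<rho> \<le> 1"
    using arith_geo_mean_sqrt[of \<delta> "1 - \<delta>"] \<delta>_pos \<delta>_less by simp
  have pow1: "?\<rho> ^ i \<le> 1" for i
    using \<rho>0 \<rho>1 by (rule power_le_one)
  {
    case 0
    \<comment> \<open>Nothing random remains: the event has the same probability, 0 or 1, in both
      worlds, and the affinity is 1.\<close>
    show ?case
      using pow1 by (auto simp: P_def pr_const affinity_def)
  next
    case (Suc r)
    show ?case
    proof (cases "q h")
      case None
      then show ?thesis
        using pow1 by (auto simp: P_def pr_const affinity_def)
    next
      case (Some e)
      have e: "e \<in> E"
        using q Some .
      define c' where "c' = cnt q D h + of_bool (e \<in> D)"
      have c': "cnt q D (h @ [v]) = c'" for v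
        using Some by (auto simp: cnt_snoc c'_def)
      have step: "P \<kappa> (Suc r) h a = P \<kappa> r (h @ [override \<kappa> a e]) a" for a \<kappa>
        using Some by (simp add: P_def)
      show ?thesis
      proof (cases "\<kappa> e")
        case (Some v)
        \<comment> \<open>A repeated query reveals nothing. It may still be counted, but a smaller
          exponent only makes the power larger.\<close>
        have "?\<rho> ^ (b - cnt q D h) \<le> ?\<rho> ^ (b - c')"
          using \<rho>0 \<rho>1 by (intro power_decreasing) (auto simp: c'_def)
        also have "\<dots> \<le> affinity (pr \<theta> (P \<kappa> r (h @ [v]))) (pr \<theta>' (P \<kappa> r (h @ [v])))"
          using Suc.IH[of "h @ [v]" \<kappa>] by (simp add: c')
        finally show ?thesis
          using Some by (simp add: step override_def[of \<kappa> _ e])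
      next
        case None
        let ?A = "\<lambda>\<theta> v. pr \<theta> (P (\<kappa>(e \<mapsto> v)) r (h @ [v]))"
        let ?p = "\<lambda>\<theta>. if \<theta> e then 1 - \<delta> else \<delta>"
        have upd: "P \<kappa> (Suc r) h (a(e := v)) = P (\<kappa>(e \<mapsto> v)) r (h @ [v]) a" for a v
          unfolding step by (simp add: P_def override_upd[of \<kappa> e, OF None])
            (simp add: override_def)
        have split: "pr \<theta> (P \<kappa> (Suc r) h) = ?p \<theta> * ?A \<theta> True + (1 - ?p \<theta>) * ?A \<theta> False" for \<theta>
          by (subst pr_split[OF e]) (simp add: upd)
        have IH: "?\<rho> ^ (b - c') \<le> affinity (?A \<theta> v) (?A \<theta>' v)" for v
          using Suc.IH[of "h @ [v]" "\<kappa>(e \<mapsto> v)"] unfolding c' .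
        have "sqrt (?p \<theta> * ?p \<theta>') * ?\<rho> ^ (b - c') + sqrt ((1 - ?p \<theta>) * (1 - ?p \<theta>')) * ?\<rho> ^ (b - c')
          \<le> sqrt (?p \<theta> * ?p \<theta>') * affinity (?A \<theta> True) (?A \<theta>' True)
            + sqrt ((1 - ?p \<theta>) * (1 - ?p \<theta>')) * affinity (?A \<theta> False) (?A \<theta>' False)"
          using \<delta>_pos \<delta>_less by (intro add_mono mult_left_mono IH) auto
        also have "\<dots> \<le> affinity (pr \<theta> (P \<kappa> (Suc r) h)) (pr \<theta>' (P \<kappa> (Suc r) h))"
          unfolding split using pr_in_01 \<delta>_pos \<delta>_less by (intro affinity_mixture) auto
        finally have main: "(sqrt (?p \<theta> * ?p \<theta>') + sqrt ((1 - ?p \<theta>) * (1 - ?p \<theta>'))) * ?\<rho> ^ (b - c')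
          \<le> affinity (pr \<theta> (P \<kappa> (Suc r) h)) (pr \<theta>' (P \<kappa> (Suc r) h))"
          by (simp add: algebra_simps)
        show ?thesis
        proof (cases "\<theta> e = \<theta>' e")
          case True
          have "?\<rho> ^ (b - cnt q D h) \<le> ?\<rho> ^ (b - c')"
            using \<rho>0 \<rho>1 by (intro power_decreasing) (auto simp: c'_def)
          moreover have "sqrt (?p \<theta> * ?p \<theta>') + sqrt ((1 - ?p \<theta>) * (1 - ?p \<theta>')) = 1"
            using True \<delta>_pos \<delta>_less by auto
          ultimately show ?thesis
            using main by simp
        next
          case False
          then have "e \<in> D"
            using D e by auto
          have sum: "sqrt (?p \<theta> * ?p \<theta>') + sqrt ((1 - ?p \<theta>) * (1 - ?p \<theta>')) = ?\<rho>"
            using False by (auto simp: mult.commute)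
          show ?thesis
          proof (cases "cnt q D h < b")
            case True
            then have "b - cnt q D h = Suc (b - c')"
              using \<open>e \<in> D\<close> by (simp add: c'_def)
            then show ?thesis
              using main unfolding sum by simp
          next
            case False
            \<comment> \<open>The budget is spent, so another query in \<open>D\<close> makes the
              event impossible in both worlds, and two zero probabilities have affinity 1.\<close>
            have "\<not> P \<kappa> (Suc r) h a" for a
              unfolding step unfolding P_def
              using cnt_run_mono[of q D "h @ [override \<kappa> a e]" "override \<kappa> a" r] False \<open>e \<in> D\<close>
              by (simp add: c' c'_def)
            then show ?thesis
              using pow1 by (simp add: pr_const affinity_def)
          qed
        qed
      qed
    qed
  }
qed

text \<open>Only queries in \<open>D\<close>, where the two worlds differ, are informative. A run that makes at most \<open>b\<close>
  of them has affinity at least \<open>(2 * sqrt (\<delta> * (1 - \<delta>))) ^ b\<close>, whose square is at least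
  \<open>1 - b * (1 - 2 * \<delta>)\<^sup>2\<close>.\<close>

lemma pr_run_le:
  fixes q :: "bool list \<Rightarrow> 'e option" and \<Phi> :: "bool list \<Rightarrow> bool" and b :: nat
  assumes q: "\<And>h e. q h = Some e \<Longrightarrow> e \<in> E"
    and D: "\<And>e. e \<in> E - D \<Longrightarrow> \<theta> e = \<theta>' e"
  shows "pr \<theta> (\<lambda>a. \<Phi> (run q a r []))
    \<le> pr \<theta>' (\<lambda>a. \<Phi> (run q a r [])) + (1 - 2 * \<delta>) * sqrt b + pr \<theta> (\<lambda>a. b < cnt q D (run q a r []))"
proof -
  define P where "P = (\<lambda>a. cnt q D (run q a r []) \<le> b \<and> \<Phi> (run q a r []))"
  let ?s = "1 - 2 * \<delta>" and ?\<rho> = "2 * sqrt (\<delta> * (1 - \<delta>))"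
  have "override Map.empty a = a" for a :: "'e \<Rightarrow> bool"
    by (simp add: override_def fun_eq_iff)
  then have "?\<rho> ^ b \<le> affinity (pr \<theta> P) (pr \<theta>' P)"
    using affinity_run[OF q D, where \<kappa> = Map.empty and h = "[]" and b = b and \<Phi> = \<Phi> and r = r]
    by (simp add: P_def)
  moreover have "0 \<le> ?\<rho>"
    using \<delta>_pos \<delta>_less by simp
  ultimately have "(?\<rho> ^ b)\<^sup>2 \<le> (affinity (pr \<theta> P) (pr \<theta>' P))\<^sup>2"
    by (intro power_mono) auto
  moreover have "(?\<rho> ^ b)\<^sup>2 = (1 - ?s\<^sup>2) ^ b"
  proof -
    have "?\<rho>\<^sup>2 = 1 - ?s\<^sup>2"
      using \<delta>_pos \<delta>_less by (simp add: power_mult_distrib) (simp add: power2_eq_square algebra_simps)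
    then show ?thesis
      by (metis power_mult mult.commute)
  qed
  moreover have "1 - b * ?s\<^sup>2 \<le> (1 - ?s\<^sup>2) ^ b"
    using Bernoulli_inequality[of "- ?s\<^sup>2" b] \<delta>_pos \<delta>_less by (simp add: power_le_one)
  moreover have "(pr \<theta> P - pr \<theta>' P)\<^sup>2 \<le> 1 - (affinity (pr \<theta> P) (pr \<theta>' P))\<^sup>2"
    using pr_in_01 by (intro diff_le_affinity) auto
  ultimately have "(pr \<theta> P - pr \<theta>' P)\<^sup>2 \<le> (?s * sqrt b)\<^sup>2"
    by (simp add: power_mult_distrib mult.commute)
  then have "pr \<theta> P - pr \<theta>' P \<le> ?s * sqrt b"
    by (rule power2_le_imp_le[OF order.trans]) (use \<delta>_less in auto)
  moreover have "pr \<theta> (\<lambda>a. \<Phi> (run q a r [])) \<le> pr \<theta> (\<lambda>a. P a \<or> b < cnt q D (run q a r []))"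
    by (rule pr_mono) (auto simp: P_def)
  moreover have "\<dots> \<le> pr \<theta> P + pr \<theta> (\<lambda>a. b < cnt q D (run q a r []))"
    by (rule pr_disj_le)
  \<comment> \<open>In \<open>\<theta>'\<close> the budget condition is dropped by monotonicity, so
    overflow is charged in \<open>\<theta>\<close> only.\<close>
  moreover have "pr \<theta>' P \<le> pr \<theta>' (\<lambda>a. \<Phi> (run q a r []))"
    by (rule pr_mono) (auto simp: P_def)
  ultimately show ?thesis
    by linarith
qed

end

section \<open>From algorithms to bit strategies\<close>

definition same :: "('p \<Rightarrow> 'q) \<Rightarrow> 'p set \<Rightarrow> bool" where
  "same f e \<longleftrightarrow> (\<forall>x\<in>e. \<forall>y\<in>e. f x = f y)"

definition bit_dist :: "real \<Rightarrow> bool \<Rightarrow> real" where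
  "bit_dist \<epsilon> v = (if v then \<epsilon> else 1)"

definition cluster_dist :: "real \<Rightarrow> ('p \<Rightarrow> 'q) \<Rightarrow> 'p \<Rightarrow> 'p \<Rightarrow> real" where
  "cluster_dist \<epsilon> f x y = (if x = y then 0 else bit_dist \<epsilon> (f x = f y))"

text \<open>The adversary answers a corrupted query with the wrong one of the two distances, so every
  answer is the true bit sent through a binary symmetric channel.\<close>

definition flipped_dist :: "real \<Rightarrow> ('p \<Rightarrow> 'q) \<Rightarrow> 'p set \<Rightarrow> real" where
  "flipped_dist \<epsilon> f e = bit_dist \<epsilon> (\<not> same f e)"

definition pairs :: "'p set \<Rightarrow> 'p set set" where
  "pairs X = {{x, y} | x y. x \<in> X \<and> y \<in> X \<and> x \<noteq> y}"

definition next_pair :: "real \<Rightarrow> 'p strategy \<Rightarrow> bool list \<Rightarrow> 'p set option" where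
  "next_pair \<epsilon> S h = (case S (map (bit_dist \<epsilon>) h) of Query x y \<Rightarrow> Some {x, y} | Output C \<Rightarrow> None)"

text \<open>This necessary condition for an approximate solution depends on the bit history only,
  which makes it an event for \<open>run\<close>.\<close>

definition solved ::
  "real \<Rightarrow> 'p set \<Rightarrow> nat \<Rightarrow> ('p \<Rightarrow> 'q) \<Rightarrow> 'p strategy \<Rightarrow> bool list \<Rightarrow> bool" where
  "solved \<epsilon> X k f S h \<longleftrightarrow>
    (\<exists>C. S (map (bit_dist \<epsilon>) h) = Output C \<and> C \<subseteq> X \<and> card C = k \<and> f ` C = f ` X)"

lemma finite_pairs: "finite X \<Longrightarrow> finite (pairs X)"
  by (rule finite_subset[of _ "Pow X"]) (auto simp: pairs_def)

lemma Metric_space_cluster_dist: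
  assumes "0 < \<epsilon>" "\<epsilon> \<le> 1"
  shows "Metric_space X (cluster_dist \<epsilon> f)"
  using assms by unfold_locales (auto simp: cluster_dist_def bit_dist_def)

text \<open>One centre per cluster costs at most \<open>card X * \<epsilon>\<close>, so an
  approximate solution costs less than 1, whereas a point of a cluster without centre alone pays
  1.\<close>

lemma approx_kmedian_cluster_dist:
  fixes f :: "'p \<Rightarrow> 'q" and \<epsilon> c :: real
  assumes "finite X" "0 < k" "card (f ` X) = k" "0 < \<epsilon>" "\<epsilon> \<le> 1" "c * card X * \<epsilon> < 1" "1 \<le> c"
    and approx: "approx_kmedian c (cluster_dist \<epsilon> f) X k C"
  shows "C \<subseteq> X \<and> card C = k \<and> f ` C = f ` X"
proof -
  let ?d = "cluster_dist \<epsilon> f"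
  have C: "C \<subseteq> X" "card C = k" and le: "kmedian_cost ?d X C \<le> c * kmedian_opt ?d X k"
    using approx by (auto simp: approx_kmedian_def)
  have "finite C" "C \<noteq> {}"
    using C \<open>finite X\<close> \<open>0 < k\<close> by (auto intro: finite_subset)
  obtain C0 where C0: "C0 \<subseteq> X" "inj_on f C0" "f ` X = f ` C0"
    using subset_image_inj[of "f ` X" f X] by auto
  have "finite C0" "card C0 = k"
    using C0 assms(1,3) by (auto intro: finite_subset simp: card_image)
  have "kmedian_cost ?d X C0 \<le> (\<Sum>x\<in>X. \<epsilon>)"
    unfolding kmedian_cost_def
  proof (rule sum_mono)
    fix x assume "x \<in> X"
    then obtain z where "z \<in> C0" "f x = f z"
      using C0(3) by auto
    then show "(MIN z\<in>C0. ?d x z) \<le> \<epsilon>"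
      using \<open>finite C0\<close> \<open>0 < \<epsilon>\<close>
      by (intro order.trans[OF Min_le[of _ "?d x z"]]) (auto simp: cluster_dist_def bit_dist_def)
  qed
  moreover have "kmedian_opt ?d X k \<le> kmedian_cost ?d X C0"
    unfolding kmedian_opt_def using C0(1) \<open>card C0 = k\<close> \<open>finite X\<close>
    by (intro Min_le) auto
  ultimately have "kmedian_opt ?d X k \<le> card X * \<epsilon>"
    by simp
  then have "c * kmedian_opt ?d X k \<le> c * (card X * \<epsilon>)"
    using \<open>1 \<le> c\<close> by (intro mult_left_mono) auto
  then have cost: "kmedian_cost ?d X C < 1"
    using le \<open>c * card X * \<epsilon> < 1\<close> by simp
  have "f x \<in> f ` C" if "x \<in> X" for x
  proof -
    have "(MIN z\<in>C. ?d x z) \<le> kmedian_cost ?d X C"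
      unfolding kmedian_cost_def using that \<open>finite X\<close>
    proof (intro member_le_sum)
      show "0 \<le> (MIN z\<in>C. ?d y z)" for y
        using \<open>finite C\<close> \<open>C \<noteq> {}\<close> \<open>0 < \<epsilon>\<close>
        by (intro Min.boundedI) (auto simp: cluster_dist_def bit_dist_def)
    qed auto
    moreover have "(MIN z\<in>C. ?d x z) \<in> ?d x ` C"
      using \<open>finite C\<close> \<open>C \<noteq> {}\<close> by (intro Min_in) auto
    ultimately obtain z where "z \<in> C" "?d x z < 1"
      using cost by auto
    then have "f x = f z"
      by (auto simp: cluster_dist_def bit_dist_def split: if_splits)
    then show ?thesis
      using \<open>z \<in> C\<close> by auto
  qed
  then show ?thesis
    using C by auto
qed

section \<open>Simulating an algorithm by a bit strategy\<close>

lemma weak_oracle_cluster_dist: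
  assumes "x \<noteq> y"
  shows "weak_oracle (cluster_dist \<epsilon> f) (flipped_dist \<epsilon> f) N x y = bit_dist \<epsilon> (same f {x, y} \<noteq> N {x, y})"
  using assms by (auto simp: weak_oracle_def cluster_dist_def flipped_dist_def same_def
      intro!: arg_cong[where f = "bit_dist \<epsilon>"])

text \<open>The answer on a pair \<open>e\<close> encodes its true bit xor \<open>N e\<close>, which
  is what \<open>pr (same f)\<close> feeds to a run. Legality makes the queried points
  distinct.\<close>

lemma answers_eq_run:
  assumes "\<And>h. S h \<in> legal_actions X"
  shows "answers (weak_oracle (cluster_dist \<epsilon> f) (flipped_dist \<epsilon> f) N) S t
    = map (bit_dist \<epsilon>) (run (next_pair \<epsilon> S) (\<lambda>e. same f e \<noteq> N e) t [])"
proof (induction t)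
  case (Suc t)
  define h where "h = run (next_pair \<epsilon> S) (\<lambda>e. same f e \<noteq> N e) t []"
  show ?case
    unfolding answers.simps run_Suc Suc.IH h_def[symmetric]
    using assms[of "map (bit_dist \<epsilon>) h"]
    by (auto simp: next_pair_def legal_actions_def weak_oracle_cluster_dist split: action.splits)
qed simp

lemma next_pair_in_pairs:
  assumes "\<And>h. S h \<in> legal_actions X" "next_pair \<epsilon> S h = Some e"
  shows "e \<in> pairs X"
  using assms(1)[of "map (bit_dist \<epsilon>) h"] assms(2)
  by (auto simp: next_pair_def legal_actions_def pairs_def split: action.splits)

section \<open>Halting, truncation and measurability\<close>

lemma length_answers:
  assumes "\<And>s C. s \<le> t \<Longrightarrow> S (answers w S s) \<noteq> Output C"
  shows "length (answers w S (Suc t)) = Suc t"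
proof -
  have "s \<le> Suc t \<Longrightarrow> length (answers w S s) = s" for s
  proof (induction s)
    case (Suc s)
    then show ?case
      using assms[of s] by (cases "S (answers w S s)") auto
  qed simp
  then show ?thesis
    by blast
qed

lemma answers_stable:
  assumes "S (answers w S s) = Output C" "s \<le> t"
  shows "answers w S t = answers w S s"
  using assms(2) by (induction t rule: dec_induct) (auto simp: assms(1))

text \<open>If none of the actions at times \<open>0\<close> to \<open>B\<close> is an output, all
  \<open>Suc B\<close> of them are queries. An output by time \<open>B\<close> is final, hence
  satisfies \<open>P\<close>.\<close>

lemma succeeds_in_time_or_many_queries:
  assumes "outputs w S C" "P C"
  shows "(\<exists>C. S (answers w S B) = Output C \<and> P C) \<or> of_nat (Suc B) \<le> num_queries w S"
proof (cases "\<exists>s C. s \<le> B \<and> S (answers w S s) = Output C")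
  case True
  then obtain s C' where s: "s \<le> B" "S (answers w S s) = Output C'"
    by auto
  obtain t where t: "S (answers w S t) = Output C"
    using assms(1) by (auto simp: outputs_def)
  have "answers w S s = answers w S t"
    using answers_stable[of S w s C' t] answers_stable[of S w t C s] s(2) t by (cases "s \<le> t") auto
  then show ?thesis
    using answers_stable[of S w s C' B] s t assms(2) by auto
next
  case False
  then have "of_nat (length (answers w S (Suc B))) = (of_nat (Suc B) :: ennreal)"
    by (subst length_answers) auto
  then show ?thesis
    unfolding num_queries_def by (metis SUP_upper UNIV_I)
qed

text \<open>For finite \<open>X\<close> and a fixed oracle only countably many answer lists occur,
  so measurability of the action for each single history carries over to the whole run.\<close>

lemma measurable_answers:
  assumes alg: "randomized_algorithm X M A" and "finite X"
  obtains R where "countable R" "\<And>t. (\<lambda>\<omega>. answers w (A \<omega>) t) \<in> M \<rightarrow>\<^sub>M count_space R"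
proof
  define R where "R = lists ((\<lambda>(x, y). w x y) ` (X \<times> X))"
  show "countable R"
    unfolding R_def using \<open>finite X\<close> by (intro countable_lists countable_finite) auto
  show "(\<lambda>\<omega>. answers w (A \<omega>) t) \<in> M \<rightarrow>\<^sub>M count_space R" for t
  proof (induction t)
    case 0
    show ?case
      by (auto simp: R_def)
  next
    case (Suc t)
    let ?F = "\<lambda>h a. case a of Query x y \<Rightarrow> h @ [w x y] | Output C \<Rightarrow> h"
    have "(\<lambda>\<omega>. ?F h (A \<omega> h)) \<in> M \<rightarrow>\<^sub>M count_space R" if "h \<in> R" for h
    proof (rule measurable_compose[of _ _ "count_space (legal_actions X)"])
      show "(\<lambda>\<omega>. A \<omega> h) \<in> M \<rightarrow>\<^sub>M count_space (legal_actions X)"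
        using alg by (auto simp: randomized_algorithm_def)
      show "?F h \<in> count_space (legal_actions X) \<rightarrow>\<^sub>M count_space R"
        using that by (auto simp: legal_actions_def R_def)
    qed
    then show ?case
      using measurable_compose_countable'[OF _ Suc.IH \<open>countable R\<close>,
          of "\<lambda>h \<omega>. ?F h (A \<omega> h)" "count_space R"] by simp
  qed
qed

lemma measurable_next_action:
  assumes alg: "randomized_algorithm X M A" and "finite X"
  shows "(\<lambda>\<omega>. A \<omega> (answers w (A \<omega>) t)) \<in> M \<rightarrow>\<^sub>M count_space (legal_actions X)"
proof -
  obtain R where R: "countable R" "\<And>t. (\<lambda>\<omega>. answers w (A \<omega>) t) \<in> M \<rightarrow>\<^sub>M count_space R"
    using measurable_answers[OF assms] by blast
  have "(\<lambda>\<omega>. A \<omega> h) \<in> M \<rightarrow>\<^sub>M count_space (legal_actions X)" for h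
    using alg by (auto simp: randomized_algorithm_def)
  then show ?thesis
    using measurable_compose_countable'[OF _ R(2,1), of "\<lambda>h \<omega>. A \<omega> h"] by simp
qed

lemma measurable_num_queries:
  assumes "randomized_algorithm X M A" "finite X"
  shows "(\<lambda>\<omega>. num_queries w (A \<omega>)) \<in> borel_measurable M"
proof -
  obtain R where R: "countable R" "\<And>t. (\<lambda>\<omega>. answers w (A \<omega>) t) \<in> M \<rightarrow>\<^sub>M count_space R"
    using measurable_answers[OF assms] by blast
  have "(\<lambda>\<omega>. of_nat (length (answers w (A \<omega>) t)) :: ennreal) \<in> borel_measurable M" for t
    by (rule measurable_compose[OF R(2)]) simp
  then show ?thesis
    unfolding num_queries_def by (intro borel_measurable_SUP) auto
qed

text \<open>Markov's inequality, pointwise: a successful tape has either succeeded by time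
  \<open>B\<close> or makes at least \<open>Suc B\<close> queries.\<close>

lemma nn_integral_succeeds_le:
  fixes B :: nat
  assumes alg: "randomized_algorithm X M A" and "finite X"
  shows "ennreal (\<P>(\<omega> in M. \<exists>C. outputs w (A \<omega>) C \<and> P C))
    \<le> (\<integral>\<^sup>+\<omega>. of_bool (\<exists>C. A \<omega> (answers w (A \<omega>) B) = Output C \<and> P C) \<partial>M)
      + (\<integral>\<^sup>+\<omega>. num_queries w (A \<omega>) \<partial>M) / of_nat (Suc B)"
proof -
  interpret prob_space M
    using alg by (simp add: randomized_algorithm_def)
  let ?Z = "{\<omega>\<in>space M. \<exists>C. outputs w (A \<omega>) C \<and> P C}"
  let ?F = "\<lambda>\<omega>. of_bool (\<exists>C. A \<omega> (answers w (A \<omega>) B) = Output C \<and> P C) :: ennreal"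
  have act: "(\<lambda>\<omega>. A \<omega> (answers w (A \<omega>) t)) \<in> M \<rightarrow>\<^sub>M count_space (legal_actions X)" for t
    by (rule measurable_next_action[OF assms])
  have [measurable]: "?F \<in> borel_measurable M"
    by (rule measurable_compose[OF act]) simp
  have [measurable]: "(\<lambda>\<omega>. num_queries w (A \<omega>)) \<in> borel_measurable M"
    by (rule measurable_num_queries[OF assms])
  have "?Z \<in> sets M"
  proof -
    have "Measurable.pred M (\<lambda>\<omega>. \<exists>C. A \<omega> (answers w (A \<omega>) t) = Output C \<and> P C)" for t
      by (rule measurable_compose[OF act]) simp
    then have "Measurable.pred M (\<lambda>\<omega>. \<exists>t. \<exists>C. A \<omega> (answers w (A \<omega>) t) = Output C \<and> P C)"
      by (rule pred_intros_countable)
    moreover have "?Z = {\<omega>\<in>space M. \<exists>t. \<exists>C. A \<omega> (answers w (A \<omega>) t) = Output C \<and> P C}"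
      by (auto simp: outputs_def)
    ultimately show ?thesis
      by (simp add: pred_def)
  qed
  then have "ennreal (prob ?Z) = (\<integral>\<^sup>+\<omega>. indicator ?Z \<omega> \<partial>M)"
    by (simp add: emeasure_eq_measure)
  also have "\<dots> \<le> (\<integral>\<^sup>+\<omega>. ?F \<omega> + num_queries w (A \<omega>) / of_nat (Suc B) \<partial>M)"
  proof (rule nn_integral_mono)
    fix \<omega> assume "\<omega> \<in> space M"
    show "indicator ?Z \<omega> \<le> ?F \<omega> + num_queries w (A \<omega>) / of_nat (Suc B)"
    proof (cases "\<omega> \<in> ?Z")
      case True
      then obtain C where "outputs w (A \<omega>) C" "P C"
        by auto
      then consider "?F \<omega> = 1" | "of_nat (Suc B) \<le> num_queries w (A \<omega>)"
        using succeeds_in_time_or_many_queries[of w "A \<omega>" C P B] by auto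
      then show ?thesis
      proof cases
        case 2
        have "(1 :: ennreal) = of_nat (Suc B) / of_nat (Suc B)"
          using ennreal_divide_self[of "of_nat (Suc B)"] by (metis ennreal_of_nat_eq_real_of_nat ennreal_less_top less_top of_nat_eq_0_iff Zero_not_Suc)
        also have "\<dots> \<le> num_queries w (A \<omega>) / of_nat (Suc B)"
          using 2 by (rule divide_right_mono_ennreal)
        finally show ?thesis
          using True by (simp add: add_increasing del: of_nat_Suc)
      qed (use True in \<open>simp add: add_increasing2 del: of_nat_Suc\<close>)
    qed simp
  qed
  also have "\<dots> = (\<integral>\<^sup>+\<omega>. ?F \<omega> \<partial>M) + (\<integral>\<^sup>+\<omega>. num_queries w (A \<omega>) \<partial>M) / of_nat (Suc B)"
    by (subst nn_integral_add) (auto simp: nn_integral_divide simp del: of_nat_Suc)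
  finally show ?thesis .
qed

text \<open>Averaging as in Yao's principle. If every \<open>i\<close> had fewer expected queries,
  truncation at \<open>B\<close> would leave a success probability above \<open>3/4 - \<eta>\<close>
  on each; summed over \<open>I\<close> and averaged over noise and tape, this contradicts
  \<open>bound\<close> for the strategies selected by the tape.\<close>

lemma expected_queries_ge:
  fixes f :: "'i \<Rightarrow> 'p \<Rightarrow> 'q" and B :: nat and c \<epsilon> \<eta> :: real
  assumes alg: "randomized_algorithm X M A" and X: "finite X"
    and \<delta>: "0 < \<delta>" "\<delta> < 1/2" and \<epsilon>: "0 < \<epsilon>" "\<epsilon> \<le> 1" "c * card X * \<epsilon> < 1" and "1 \<le> c"
    and I: "finite I" "I \<noteq> {}" and k: "0 < k" "\<And>i. i \<in> I \<Longrightarrow> card (f i ` X) = k"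
    and "\<eta> \<le> 3/4"
    and success: "\<And>i. i \<in> I \<Longrightarrow>
      3/4 \<le> success_prob c X k \<delta> (cluster_dist \<epsilon> (f i)) (flipped_dist \<epsilon> (f i)) M A"
    and bound: "\<And>S. (\<And>h. S h \<in> legal_actions X) \<Longrightarrow>
      (\<Sum>i\<in>I. noisy_bits.pr (pairs X) \<delta> (same (f i))
         (\<lambda>a. solved \<epsilon> X k (f i) S (run (next_pair \<epsilon> S) a B []))) \<le> card I * (3/4 - \<eta>)"
  shows "\<exists>i\<in>I. ennreal (\<eta> * Suc B)
    \<le> expected_queries X \<delta> (cluster_dist \<epsilon> (f i)) (flipped_dist \<epsilon> (f i)) M A"
proof (rule ccontr)
  assume neg: "\<not> ?thesis"
  interpret prob_space M
    using alg by (simp add: randomized_algorithm_def)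
  interpret noisy_bits "pairs X" \<delta>
    using \<delta> finite_pairs[OF X] by unfold_locales auto
  have noise: "corruption_pmf X \<delta> = noise"
    by (simp add: corruption_pmf_def pairs_def)
  have fin: "finite (set_pmf noise)"
    using finite_E by (auto simp: set_Pi_pmf)
  have legal: "A \<omega> h \<in> legal_actions X" if "\<omega> \<in> space M" for \<omega> h
    using alg that measurable_space[of "\<lambda>\<omega>. A \<omega> h" M "count_space (legal_actions X)" \<omega>]
    by (auto simp: randomized_algorithm_def)
  let ?w = "\<lambda>i N. weak_oracle (cluster_dist \<epsilon> (f i)) (flipped_dist \<epsilon> (f i)) N"
  let ?ok = "\<lambda>i. approx_kmedian c (cluster_dist \<epsilon> (f i)) X k"
  define F where "F = (\<lambda>i N \<omega>. of_bool (\<exists>C. A \<omega> (answers (?w i N) (A \<omega>) B) = Output C \<and> ?ok i C) :: ennreal)"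
  define Q where "Q = (\<lambda>i. expected_queries X \<delta> (cluster_dist \<epsilon> (f i)) (flipped_dist \<epsilon> (f i)) M A)"
  have F [measurable]: "F i N \<in> borel_measurable M" for i N
    unfolding F_def by (rule measurable_compose[OF measurable_next_action[OF alg X]]) simp
  have F_le: "(\<integral>\<^sup>+N. F i N \<omega> \<partial>measure_pmf noise)
      \<le> ennreal (pr (same (f i)) (\<lambda>a. solved \<epsilon> X k (f i) (A \<omega>) (run (next_pair \<epsilon> (A \<omega>)) a B [])))"
    if "i \<in> I" "\<omega> \<in> space M" for i \<omega>
  proof -
    have "F i N \<omega> \<le> indicator {N. solved \<epsilon> X k (f i) (A \<omega>)
        (run (next_pair \<epsilon> (A \<omega>)) (\<lambda>e. same (f i) e \<noteq> N e) B [])} N" for N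
      using approx_kmedian_cluster_dist[OF X k(1) k(2)[OF that(1)] \<epsilon> \<open>1 \<le> c\<close>]
      by (auto simp: F_def solved_def answers_eq_run[OF legal[OF that(2)]] indicator_def)
    then have "(\<integral>\<^sup>+N. F i N \<omega> \<partial>measure_pmf noise) \<le> (\<integral>\<^sup>+N. indicator {N. solved \<epsilon> X k (f i) (A \<omega>)
        (run (next_pair \<epsilon> (A \<omega>)) (\<lambda>e. same (f i) e \<noteq> N e) B [])} N \<partial>measure_pmf noise)"
      by (intro nn_integral_mono)
    then show ?thesis
      by (simp add: pr_def measure_pmf.emeasure_eq_measure)
  qed
  \<comment> \<open>The noise has finite support, so this exchanges a finite sum with an
    integral.\<close>
  have swap: "(\<integral>\<^sup>+N. \<integral>\<^sup>+\<omega>. F i N \<omega> \<partial>M \<partial>measure_pmf noise) = (\<integral>\<^sup>+\<omega>. \<integral>\<^sup>+N. F i N \<omega> \<partial>noise \<partial>M)" for i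
    by (simp add: nn_integral_measure_pmf_finite[OF fin] nn_integral_sum nn_integral_multc)
  have [measurable]: "(\<lambda>\<omega>. \<integral>\<^sup>+N. F i N \<omega> \<partial>measure_pmf noise) \<in> borel_measurable M" for i
    by (simp add: nn_integral_measure_pmf_finite[OF fin])
  have "(\<Sum>i\<in>I. \<integral>\<^sup>+N. \<integral>\<^sup>+\<omega>. F i N \<omega> \<partial>M \<partial>measure_pmf noise) = (\<integral>\<^sup>+\<omega>. (\<Sum>i\<in>I. \<integral>\<^sup>+N. F i N \<omega> \<partial>measure_pmf noise) \<partial>M)"
    unfolding swap by (rule nn_integral_sum[symmetric]) simp
  also have "\<dots> \<le> (\<integral>\<^sup>+\<omega>. ennreal (real (card I) * (3/4 - \<eta>)) \<partial>M)"
  proof (rule nn_integral_mono)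
    fix \<omega> assume \<omega>: "\<omega> \<in> space M"
    have "(\<Sum>i\<in>I. \<integral>\<^sup>+N. F i N \<omega> \<partial>measure_pmf noise) \<le> (\<Sum>i\<in>I. ennreal (pr (same (f i))
        (\<lambda>a. solved \<epsilon> X k (f i) (A \<omega>) (run (next_pair \<epsilon> (A \<omega>)) a B []))))"
      using \<omega> by (intro sum_mono F_le)
    also have "\<dots> \<le> ennreal (real (card I) * (3/4 - \<eta>))"
      using bound[of "A \<omega>", OF legal[OF \<omega>]] pr_in_01 by (simp add: ennreal_leI)
    finally show "(\<Sum>i\<in>I. \<integral>\<^sup>+N. F i N \<omega> \<partial>measure_pmf noise) \<le> ennreal (real (card I) * (3/4 - \<eta>))" .
  qed
  finally have sum_F: "(\<Sum>i\<in>I. \<integral>\<^sup>+N. \<integral>\<^sup>+\<omega>. F i N \<omega> \<partial>M \<partial>measure_pmf noise) \<le> ennreal (real (card I) * (3/4 - \<eta>))"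
    by (simp add: emeasure_space_1)
  have le: "ennreal (3/4) \<le> (\<integral>\<^sup>+N. \<integral>\<^sup>+\<omega>. F i N \<omega> \<partial>M \<partial>measure_pmf noise) + Q i / of_nat (Suc B)" if "i \<in> I" for i
  proof -
    have "ennreal (3/4) \<le> ennreal (success_prob c X k \<delta> (cluster_dist \<epsilon> (f i)) (flipped_dist \<epsilon> (f i)) M A)"
      using success[OF that] by (rule ennreal_leI)
    also have "\<dots> = (\<integral>\<^sup>+N. ennreal (\<P>(\<omega> in M. \<exists>C. outputs (?w i N) (A \<omega>) C \<and> ?ok i C)) \<partial>measure_pmf noise)"
      unfolding success_prob_def noise
      by (rule nn_integral_eq_integral[symmetric]) (auto intro: integrable_measure_pmf_finite[OF fin])
    also have "\<dots> \<le> (\<integral>\<^sup>+N. (\<integral>\<^sup>+\<omega>. F i N \<omega> \<partial>M) + (\<integral>\<^sup>+\<omega>. num_queries (?w i N) (A \<omega>) \<partial>M) / of_nat (Suc B) \<partial>measure_pmf noise)"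
      unfolding F_def by (intro nn_integral_mono nn_integral_succeeds_le[OF alg X])
    also have "\<dots> = (\<integral>\<^sup>+N. \<integral>\<^sup>+\<omega>. F i N \<omega> \<partial>M \<partial>measure_pmf noise) + Q i / of_nat (Suc B)"
      by (simp add: nn_integral_add nn_integral_divide Q_def expected_queries_def noise del: of_nat_Suc)
    finally show ?thesis .
  qed
  have Q_less: "Q i < ennreal (\<eta> * Suc B)" if "i \<in> I" for i
    using neg that by (auto simp: Q_def not_le)
  \<comment> \<open>All quantities are finite, so the strict inequalities can be summed over
    \<open>I\<close> in the reals.\<close>
  define s where "s = (\<lambda>i. enn2real (\<integral>\<^sup>+N. \<integral>\<^sup>+\<omega>. F i N \<omega> \<partial>M \<partial>measure_pmf noise))"
  define t where "t = (\<lambda>i. enn2real (Q i))"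
  have s: "(\<integral>\<^sup>+N. \<integral>\<^sup>+\<omega>. F i N \<omega> \<partial>M \<partial>measure_pmf noise) = ennreal (s i)" if "i \<in> I" for i
  proof -
    have "(\<integral>\<^sup>+N. \<integral>\<^sup>+\<omega>. F i N \<omega> \<partial>M \<partial>measure_pmf noise) \<le> (\<Sum>i\<in>I. \<integral>\<^sup>+N. \<integral>\<^sup>+\<omega>. F i N \<omega> \<partial>M \<partial>measure_pmf noise)"
      using I(1) that by (intro member_le_sum) auto
    also have "\<dots> < \<top>"
      using sum_F by (rule le_less_trans) simp
    finally show ?thesis
      by (simp add: s_def)
  qed
  have t: "Q i = ennreal (t i)" if "i \<in> I" for i
    using less_trans[OF Q_less[OF that] ennreal_less_top] by (simp add: t_def)
  have nonneg: "0 \<le> s i" "0 \<le> t i" for i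
    by (simp_all add: s_def t_def)
  have "3/4 - \<eta> < s i" if "i \<in> I" for i
  proof -
    have "ennreal (3/4) \<le> ennreal (s i + t i / Suc B)"
      using le[OF that] nonneg unfolding s[OF that] t[OF that]
      by (simp add: divide_ennreal ennreal_of_nat_eq_real_of_nat del: of_nat_Suc)
    then have "3/4 \<le> s i + t i / Suc B"
      using nonneg by (subst (asm) ennreal_le_iff) (auto intro!: add_nonneg_nonneg)
    moreover have "t i < \<eta> * Suc B"
      using Q_less[OF that] nonneg unfolding t[OF that] by (simp add: ennreal_less_iff del: of_nat_Suc)
    then have "t i / Suc B < \<eta>"
      by (subst pos_divide_less_eq) auto
    ultimately show ?thesis
      by linarith
  qed
  then have "(\<Sum>i\<in>I. 3/4 - \<eta>) < (\<Sum>i\<in>I. s i)"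
    using I by (intro sum_strict_mono) auto
  moreover have "ennreal (\<Sum>i\<in>I. s i) \<le> ennreal (real (card I) * (3/4 - \<eta>))"
    using sum_F nonneg by (simp add: s sum_nonneg flip: sum_ennreal)
  then have "(\<Sum>i\<in>I. s i) \<le> card I * (3/4 - \<eta>)"
    using \<open>\<eta> \<le> 3/4\<close> by (subst (asm) ennreal_le_iff) auto
  ultimately show False
    by simp
qed

context noisy_bits
begin

text \<open>Markov's inequality for counts: \<open>T\<close> queries spread over disjoint sets can
  put more than \<open>b\<close> into at most \<open>T / Suc b\<close> of them.\<close>

lemma sum_pr_cnt_le:
  assumes "finite J" "disjoint_family_on D J" "\<And>a. cnt q (\<Union>j\<in>J. D j) (run q a r []) \<le> T"
  shows "(\<Sum>j\<in>J. pr \<theta> (\<lambda>a. b < cnt q (D j) (run q a r []))) \<le> T / Suc b"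
proof (rule sum_pr_le)
  fix a
  let ?c = "\<lambda>j. cnt q (D j) (run q a r [])"
  have "(\<Sum>j\<in>J. of_bool (b < ?c j)) \<le> (\<Sum>j\<in>J. ?c j / Suc b)"
    by (intro sum_mono) auto
  also have "\<dots> = (\<Sum>j\<in>J. ?c j) / Suc b"
    by (simp add: sum_divide_distrib)
  also have "\<dots> \<le> T / Suc b"
    using order.trans[OF sum_cnt_le[OF assms(1,2)] assms(3)]
    by (intro divide_right_mono) (auto simp flip: of_nat_sum)
  finally show "(\<Sum>j\<in>J. of_bool (b < ?c j)) \<le> T / Suc b" .
qed

end

section \<open>Many clusters: a hidden merged pair\<close>

text \<open>The points from \<open>k\<close> on form one known group and the points below \<open>k\<close> are known singletons;
  of these \<open>k + 1\<close> groups, \<open>fst i\<close> is merged into \<open>snd i\<close>.\<close>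

definition merge_cluster :: "nat \<Rightarrow> nat \<times> nat \<Rightarrow> nat \<Rightarrow> nat" where
  "merge_cluster k i x = (if min x k = fst i then snd i else min x k)"

text \<open>Each unordered pair of the \<open>k + 1\<close> groups occurs once, larger index
  first.\<close>

definition merge_index :: "nat \<Rightarrow> (nat \<times> nat) set" where
  "merge_index k = (SIGMA b:{..k}. {..<b})"

lemma finite_merge_index: "finite (merge_index k)"
  by (simp add: merge_index_def)

lemma card_merge_index: "2 * card (merge_index k) = k * Suc k"
proof -
  have "card (merge_index k) = (\<Sum>b\<le>k. b)"
    by (simp add: merge_index_def)
  then show ?thesis
    by (simp add: atMost_atLeast0 gauss_sum_nat dvd_mult_div_cancel)
qed

lemma merge_cluster_image:
  assumes "k < n" "i \<in> merge_index k"
  shows "merge_cluster k i ` {..<n} = {..k} - {fst i}"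
proof -
  have "y \<in> merge_cluster k i ` {..<n}" if "y \<le> k" "y \<noteq> fst i" for y
    using that assms by (intro image_eqI[of _ _ y]) (auto simp: merge_cluster_def)
  then show ?thesis
    using assms by (auto simp: merge_cluster_def merge_index_def)
qed

lemma card_merge_cluster_image:
  assumes "k < n" "i \<in> merge_index k"
  shows "card (merge_cluster k i ` {..<n}) = k"
  using assms by (simp add: merge_cluster_image) (auto simp: merge_index_def)

text \<open>The centres of a solution lie in \<open>k\<close> different groups, so they miss exactly
  one group \<open>e\<close>, which must be one of the merged two. The output determines
  \<open>e\<close>, and only \<open>k\<close> merges involve it.\<close>

lemma card_merges_solved_le:
  assumes "k < n"
  shows "card {i \<in> merge_index k. solved \<epsilon> {..<n} k (merge_cluster k i) S h} \<le> k"
proof (cases "\<exists>C. S (map (bit_dist \<epsilon>) h) = Output C")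
  case False
  then show ?thesis
    by (auto simp: solved_def)
next
  case True
  then obtain C where C: "S (map (bit_dist \<epsilon>) h) = Output C"
    by auto
  define R where "R = (\<lambda>x. min x k) ` C"
  have miss: "\<exists>e. {..k} - R = {e} \<and> (e = fst i \<or> e = snd i)"
    if i: "i \<in> merge_index k" and "solved \<epsilon> {..<n} k (merge_cluster k i) S h" for i
  proof -
    define g where "g = (\<lambda>y. if y = fst i then snd i else y)"
    have f: "merge_cluster k i ` C = g ` R"
      by (auto simp: merge_cluster_def g_def R_def image_image)
    have sol: "card C = k" "C \<subseteq> {..<n}" "g ` R = {..k} - {fst i}"
      using that C merge_cluster_image[OF assms i] by (auto simp: solved_def f)
    have "finite C"
      using sol(2) by (rule finite_subset) simp
    have "card (g ` R) = k"
      using sol(3) i by (auto simp: merge_index_def)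
    moreover have "card (g ` R) \<le> card R" "card R \<le> card C"
      unfolding R_def using \<open>finite C\<close> by (auto intro: card_image_le)
    ultimately have card: "card R = k" "card (g ` R) = card R"
      using sol(1) by auto
    have "finite R"
      using \<open>finite C\<close> by (simp add: R_def)
    have inj: "inj_on g R"
      using \<open>finite R\<close> card(2) by (rule eq_card_imp_inj_on)
    have "R \<subseteq> {..k}"
      by (auto simp: R_def)
    then have "card ({..k} - R) = 1"
      using card \<open>finite R\<close> by (simp add: card_Diff_subset)
    then obtain e where e: "{..k} - R = {e}"
      by (auto simp: card_1_singleton_iff)
    \<comment> \<open>With centres in both merged groups, \<open>g\<close> would identify two
      elements of \<open>R\<close>.\<close>
    have "\<not> (fst i \<in> R \<and> snd i \<in> R)"
      using inj_onD[OF inj, of "fst i" "snd i"] i by (auto simp: g_def merge_index_def)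
    then have "e = fst i \<or> e = snd i"
      using e i by (auto simp: merge_index_def)
    with e show ?thesis
      by blast
  qed
  show ?thesis
  proof (cases "\<exists>e. {..k} - R = {e}")
    case False
    then have "{i \<in> merge_index k. solved \<epsilon> {..<n} k (merge_cluster k i) S h} = {}"
      using miss by blast
    then show ?thesis
      by (simp only: card.empty)
  next
    case True
    then obtain e where e: "{..k} - R = {e}"
      by auto
    then have "e \<le> k"
      by auto
    have "{i \<in> merge_index k. solved \<epsilon> {..<n} k (merge_cluster k i) S h}
        \<subseteq> (\<lambda>c. (max c e, min c e)) ` ({..k} - {e})" (is "?G \<subseteq> ?H")
    proof
      fix i assume "i \<in> ?G"
      then have i: "i \<in> merge_index k" "e = fst i \<or> e = snd i"
        using miss[of i] e by auto
      then show "i \<in> ?H"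
      proof (cases "e = fst i")
        case True
        then show ?thesis
          using i by (intro image_eqI[of _ _ "snd i"]) (auto simp: merge_index_def)
      next
        case False
        then show ?thesis
          using i by (intro image_eqI[of _ _ "fst i"]) (auto simp: merge_index_def)
      qed
    qed
    then have "card ?G \<le> card ({..k} - {e})"
      by (rule surj_card_le[rotated]) simp
    also have "\<dots> = k"
      using \<open>e \<le> k\<close> by simp
    finally show ?thesis .
  qed
qed

text \<open>Each merged world is compared with the unmerged one, where an output solves at most
  \<open>k\<close> merges and at most \<open>B\<close> queries are divided among the disjoint sets
  of pairs joining two groups.\<close>

lemma sum_pr_merge_le:
  fixes b B n k :: nat and \<delta> :: real
  assumes "k < n" "0 < \<delta>" "\<delta> < 1/2" and legal: "\<And>h. S h \<in> legal_actions {..<n}"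
  shows "(\<Sum>i\<in>merge_index k. noisy_bits.pr (pairs {..<n}) \<delta> (same (merge_cluster k i))
      (\<lambda>a. solved \<epsilon> {..<n} k (merge_cluster k i) S (run (next_pair \<epsilon> S) a B [])))
    \<le> k + card (merge_index k) * ((1 - 2 * \<delta>) * sqrt b) + B / Suc b"
proof -
  interpret noisy_bits "pairs {..<n}" \<delta>
    using assms finite_pairs by unfold_locales auto
  let ?I = "merge_index k" and ?q = "next_pair \<epsilon> S"
  let ?\<sigma> = "\<lambda>x. min x k"
  let ?sol = "\<lambda>i a. solved \<epsilon> {..<n} k (merge_cluster k i) S (run ?q a B [])"
  define D where "D = (\<lambda>i. {e. ?\<sigma> ` e = {fst i, snd i}})"
  have agree: "same ?\<sigma> e = same (merge_cluster k i) e" if "i \<in> ?I" and "e \<in> pairs {..<n} - D i" for i e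
  proof -
    obtain x y where e: "e = {x, y}" "x \<noteq> y"
      using \<open>e \<in> pairs {..<n} - D i\<close> by (auto simp: pairs_def)
    show ?thesis
      using that e unfolding same_def merge_cluster_def D_def merge_index_def by (auto split: if_splits)
  qed
  have "pr (same (merge_cluster k i)) (?sol i) \<le> pr (same ?\<sigma>) (?sol i) + (1 - 2 * \<delta>) * sqrt b
      + pr (same ?\<sigma>) (\<lambda>a. b < cnt ?q (D i) (run ?q a B []))" if "i \<in> ?I" for i
    \<comment> \<open>Failure rather than success is transferred, so that overflow is measured in
      the unmerged world, which is common to all \<open>i\<close>.\<close>
    using pr_run_le[of ?q "D i" "same ?\<sigma>" "same (merge_cluster k i)"
        "\<lambda>h. \<not> solved \<epsilon> {..<n} k (merge_cluster k i) S h" B b]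
      next_pair_in_pairs[OF legal] agree[OF that] by (simp add: pr_not)
  then have "(\<Sum>i\<in>?I. pr (same (merge_cluster k i)) (?sol i))
      \<le> (\<Sum>i\<in>?I. pr (same ?\<sigma>) (?sol i) + (1 - 2 * \<delta>) * sqrt b
        + pr (same ?\<sigma>) (\<lambda>a. b < cnt ?q (D i) (run ?q a B [])))"
    by (rule sum_mono)
  also have "\<dots> = (\<Sum>i\<in>?I. pr (same ?\<sigma>) (?sol i)) + card ?I * ((1 - 2 * \<delta>) * sqrt b)
      + (\<Sum>i\<in>?I. pr (same ?\<sigma>) (\<lambda>a. b < cnt ?q (D i) (run ?q a B [])))"
    by (simp add: sum.distrib)
  also have "\<dots> \<le> k + card ?I * ((1 - 2 * \<delta>) * sqrt b) + B / Suc b"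
  proof (intro add_mono order.refl)
    show "(\<Sum>i\<in>?I. pr (same ?\<sigma>) (?sol i)) \<le> k"
    proof (rule sum_pr_le)
      fix a
      show "(\<Sum>i\<in>?I. of_bool (?sol i a)) \<le> real k"
        using card_merges_solved_le[OF assms(1)] finite_merge_index by (simp add: sum_of_bool_eq Int_def)
    qed
    show "(\<Sum>i\<in>?I. pr (same ?\<sigma>) (\<lambda>a. b < cnt ?q (D i) (run ?q a B []))) \<le> B / Suc b"
    proof (rule sum_pr_cnt_le)
      show "disjoint_family_on D ?I"
        by (auto simp: disjoint_family_on_def D_def merge_index_def doubleton_eq_iff)
      show "cnt ?q (\<Union>i\<in>?I. D i) (run ?q a B []) \<le> B" for a
        using order.trans[OF cnt_le_length length_run[of ?q a B "[]"]] by simp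
    qed (rule finite_merge_index)
  qed
  finally show ?thesis .
qed

section \<open>Few clusters: a hidden outlier\<close>

definition stop_after ::
  "(bool list \<Rightarrow> 'e option) \<Rightarrow> 'e set \<Rightarrow> nat \<Rightarrow> bool list \<Rightarrow> 'e option" where
  "stop_after q D b h = (if q h \<in> Some ` D \<and> b \<le> cnt q D h then None else q h)"

lemma cnt_stop_after_le: "cnt (stop_after q D b) D h \<le> b"
proof -
  \<comment> \<open>The minimum ties the stopped count to the count of \<open>q\<close>, on which
    the stopping rule depends.\<close>
  have "cnt (stop_after q D b) D h \<le> min b (cnt q D h)"
  proof (induction h rule: rev_induct)
    case (snoc v h)
    then show ?case
      by (auto simp: cnt_snoc stop_after_def)
  qed simp
  then show ?thesis
    by simp
qed

lemma cnt_run_Suc: "cnt q D (run q a r h) \<le> cnt q D (run q a (Suc r) h)"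
  unfolding run_Suc by (auto simp: cnt_snoc split: option.splits)

text \<open>At the stop the original run is about to make its query number \<open>b + 1\<close> in
  \<open>D\<close>; this query enters the history one step later, hence
  \<open>Suc r\<close>.\<close>

lemma run_stop_after:
  fixes q D b a
  defines "exhausted \<equiv> \<lambda>h. q h \<in> Some ` D \<and> b \<le> cnt q D h"
  shows "run (stop_after q D b) a r [] = run q a r [] \<and> \<not> exhausted (run q a r [])
    \<or> exhausted (run (stop_after q D b) a r []) \<and> b < cnt q D (run q a (Suc r) [])"
proof -
  have next_cnt: "b < cnt q D (run q a (Suc r) [])" if "exhausted (run q a r [])" for r
    using that unfolding run_Suc by (auto simp: exhausted_def cnt_snoc)
  show ?thesis
  proof (induction r)
    case 0
    then show ?case
      using next_cnt[of 0] by auto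
  next
    case (Suc r)
    then show ?case
    proof
      assume "run (stop_after q D b) a r [] = run q a r [] \<and> \<not> exhausted (run q a r [])"
      then have "run (stop_after q D b) a (Suc r) [] = run q a (Suc r) []"
        unfolding run_Suc by (auto simp: stop_after_def exhausted_def split: option.splits)
      then show ?thesis
        using next_cnt[of "Suc r"] by auto
    next
      assume *: "exhausted (run (stop_after q D b) a r []) \<and> b < cnt q D (run q a (Suc r) [])"
      then have "run (stop_after q D b) a (Suc r) [] = run (stop_after q D b) a r []"
        unfolding run_Suc by (auto simp: stop_after_def exhausted_def)
      then show ?thesis
        using * cnt_run_Suc[of q D a "Suc r" "[]"] by auto
    qed
  qed
qed

text \<open>The points below \<open>m\<close> are known members of the \<open>m\<close> ordinary clusters.\<close>

definition base_label :: "nat \<Rightarrow> (nat \<Rightarrow> nat) \<Rightarrow> nat \<Rightarrow> nat" where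
  "base_label m l y = (if y < m then y else l y)"

text \<open>Label \<open>m\<close> lies outside the ordinary labels, and the label that
  \<open>fst i\<close> gives to the outlier is overwritten.\<close>

definition outlier_label :: "nat \<Rightarrow> (nat \<Rightarrow> nat) \<times> nat \<Rightarrow> nat \<Rightarrow> nat" where
  "outlier_label m i y = (if y = snd i then m else base_label m (fst i) y)"

definition labellings :: "nat \<Rightarrow> nat \<Rightarrow> (nat \<Rightarrow> nat) set" where
  "labellings m n = {m..<n} \<rightarrow>\<^sub>E {..<m}"

lemma finite_labellings: "finite (labellings m n)"
  by (simp add: labellings_def finite_PiE)

lemma labellings_nonempty: "0 < m \<Longrightarrow> labellings m n \<noteq> {}"
  by (auto simp: labellings_def PiE_eq_empty_iff)

lemma base_label_less: "l \<in> labellings m n \<Longrightarrow> y < n \<Longrightarrow> base_label m l y < m"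
  by (auto simp: base_label_def labellings_def PiE_def Pi_def)

lemma card_outlier_label_image:
  assumes "l \<in> labellings m n" "x \<in> {m..<n}"
  shows "card (outlier_label m (l, x) ` {..<n}) = Suc m"
proof -
  have "y \<in> outlier_label m (l, x) ` {..<n}" if "y \<le> m" for y
    using that assms(2)
    by (intro image_eqI[of _ _ "if y = m then x else y"]) (auto simp: outlier_label_def base_label_def)
  moreover have "outlier_label m (l, x) y \<le> m" if "y < n" for y
    using base_label_less[OF assms(1) that] by (simp add: outlier_label_def)
  ultimately have "outlier_label m (l, x) ` {..<n} = {..m}"
    by auto
  then show ?thesis
    by simp
qed

text \<open>Redrawing the label of \<open>x\<close> uniformly preserves the uniform distribution on
  labellings.\<close>

lemma sum_labellings_resample:
  fixes g :: "(nat \<Rightarrow> nat) \<Rightarrow> real"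
  assumes "x \<in> {m..<n}"
  shows "(\<Sum>l\<in>labellings m n. \<Sum>j<m. g (l(x := j))) = m * (\<Sum>l\<in>labellings m n. g l)"
proof -
  have "(\<Sum>l\<in>labellings m n. \<Sum>j<m. g (l(x := j))) = (\<Sum>(l, j)\<in>labellings m n \<times> {..<m}. g (l(x := j)))"
    by (rule sum.cartesian_product)
  also have "\<dots> = (\<Sum>(l, j)\<in>labellings m n \<times> {..<m}. g l)"
    \<comment> \<open>The map exchanges the label of \<open>x\<close> with \<open>j\<close> and is
      its own inverse.\<close>
    by (rule sum.reindex_bij_witness[where i = "\<lambda>(l, j). (l(x := j), l x)" and j = "\<lambda>(l, j). (l(x := j), l x)"])
      (use assms in \<open>auto simp: labellings_def PiE_def Pi_def extensional_def\<close>)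
  also have "\<dots> = m * (\<Sum>l\<in>labellings m n. g l)"
    by (simp add: sum.cartesian_product[symmetric] sum_distrib_left)
  finally show ?thesis .
qed

text \<open>Unlike \<open>solved\<close>, this does not mention the labelling, so it can be
  evaluated in the world without outlier and summed over \<open>x\<close>.\<close>

definition chosen :: "real \<Rightarrow> 'p set \<Rightarrow> nat \<Rightarrow> 'p strategy \<Rightarrow> bool list \<Rightarrow> 'p \<Rightarrow> bool" where
  "chosen \<epsilon> X k S h x \<longleftrightarrow>
    (\<exists>C. S (map (bit_dist \<epsilon>) h) = Output C \<and> C \<subseteq> X \<and> card C = k \<and> x \<in> C)"

text \<open>The outlier is alone in its cluster, so no other point can be the centre there.\<close>

lemma solved_imp_outlier_chosen:
  assumes "solved \<epsilon> {..<n} k (outlier_label m (l, x)) S h" "l \<in> labellings m n" "x < n"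
  shows "chosen \<epsilon> {..<n} k S h x"
proof -
  obtain C where C: "S (map (bit_dist \<epsilon>) h) = Output C" "C \<subseteq> {..<n}" "card C = k"
      "outlier_label m (l, x) ` C = outlier_label m (l, x) ` {..<n}"
    using assms(1) by (auto simp: solved_def)
  have "outlier_label m (l, x) x \<in> outlier_label m (l, x) ` C"
    unfolding C(4) using assms(3) by auto
  then obtain y where "y \<in> C" "outlier_label m (l, x) y = m"
    by (auto simp: outlier_label_def)
  then have "y = x"
    using base_label_less[OF assms(2), of y] C(2) by (auto simp: outlier_label_def split: if_splits)
  then show ?thesis
    using C \<open>y \<in> C\<close> by (auto simp: chosen_def)
qed

lemma card_chosen_le:
  assumes "finite X" "finite U"
  shows "(\<Sum>x\<in>U. of_bool (chosen \<epsilon> X k S h x)) \<le> real k"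
proof (cases "\<exists>x. chosen \<epsilon> X k S h x")
  case True
  then obtain C where C: "S (map (bit_dist \<epsilon>) h) = Output C" "C \<subseteq> X" "card C = k"
    by (auto simp: chosen_def)
  have "finite C"
    using C(2) assms(1) by (rule finite_subset)
  then have "card (U \<inter> {x. chosen \<epsilon> X k S h x}) \<le> card C"
    using C by (intro card_mono) (auto simp: chosen_def)
  then show ?thesis
    using assms C by (simp add: sum_of_bool_eq)
qed simp

text \<open>A queried pair has two ends, so it counts for at most two points.\<close>

lemma sum_cnt_touching_le:
  assumes q: "\<And>h e. q h = Some e \<Longrightarrow> e \<in> pairs X" and "finite U"
  shows "(\<Sum>x\<in>U. cnt q {e. x \<in> e} h) \<le> 2 * length h"
proof -
  have "(\<Sum>x\<in>U. of_bool (q h \<in> Some ` {e. x \<in> e})) \<le> (2 :: nat)" for h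
  proof (cases "q h")
    case (Some e)
    then obtain y z where e: "e = {y, z}"
      using q[OF Some] by (auto simp: pairs_def)
    have "(\<Sum>x\<in>U. of_bool (q h \<in> Some ` {e. x \<in> e})) = card (U \<inter> e)"
      using \<open>finite U\<close> Some by (simp add: sum_of_bool_eq image_iff)
    also have "\<dots> \<le> card {y, z}"
      unfolding e by (intro card_mono) auto
    also have "\<dots> \<le> 2"
      by (simp add: card_insert_if)
    finally show ?thesis .
  qed auto
  then have "(\<Sum>i<length h. \<Sum>x\<in>U. of_bool (q (take i h) \<in> Some ` {e. x \<in> e})) \<le> (\<Sum>i<length h. 2 :: nat)"
    by (intro sum_mono)
  then show ?thesis
    unfolding cnt_def by (subst sum.swap) simp
qed

text \<open>If \<open>x\<close> is the outlier, its queries before the stopping rule are spread over the \<open>m\<close> possible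
  clusters of \<open>x\<close>, each of which would have been the right one in an equally likely labelling. Hence
  the run cannot tell whether \<open>x\<close> is an outlier or an ordinary point, unless \<open>x\<close> is
  involved in more than \<open>b\<close> queries; for ordinary points this can happen only \<open>2 * Suc B / Suc b\<close> times.\<close>

lemma sum_pr_outlier_le:
  fixes b b' B m n :: nat and \<delta> :: real
  assumes "0 < m" "m < n" "0 < \<delta>" "\<delta> < 1/2" and legal: "\<And>h. S h \<in> legal_actions {..<n}"
  shows "(\<Sum>i\<in>labellings m n \<times> {m..<n}. noisy_bits.pr (pairs {..<n}) \<delta> (same (outlier_label m i))
      (\<lambda>a. solved \<epsilon> {..<n} (Suc m) (outlier_label m i) S (run (next_pair \<epsilon> S) a B [])))
    \<le> card (labellings m n) * (Suc m + 2 * Suc B / Suc b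
        + (n - m) * ((1 - 2 * \<delta>) * sqrt b' + b / (Suc b' * m)))"
proof -
  interpret noisy_bits "pairs {..<n}" \<delta>
    using assms finite_pairs by unfold_locales auto
  let ?L = "labellings m n" and ?U = "{m..<n}" and ?q = "next_pair \<epsilon> S"
  let ?sol = "\<lambda>i a. solved \<epsilon> {..<n} (Suc m) (outlier_label m i) S (run ?q a B [])"
  let ?ch = "\<lambda>x h. chosen \<epsilon> {..<n} (Suc m) S h x"
  define T where "T = (\<lambda>x::nat. {e. x \<in> e})"
  \<comment> \<open>The worlds with and without outlier \<open>x\<close> differ only on
    \<open>D x l (l x)\<close>, the pairs joining \<open>x\<close> to its cluster under
    \<open>l\<close>.\<close>
  define D where "D = (\<lambda>x l j. {e. x \<in> e \<and> base_label m l ` (e - {x}) = {j}})"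
  define q' where "q' = (\<lambda>x. stop_after ?q (T x) b)"
  define G where "G = (\<lambda>x a. ?ch x (run ?q a B []) \<or> b < cnt ?q (T x) (run ?q a (Suc B) []))"
  \<comment> \<open>Overflow is measured in the outlier world, where the answers carry no trace of
    \<open>l x\<close>.\<close>
  define R where "R = (\<lambda>x l. pr (same (outlier_label m (l, x))) (\<lambda>a. b' < cnt (q' x) (D x l (l x)) (run (q' x) a B [])))"
  have q: "e \<in> pairs {..<n}" if "?q h = Some e" for h e
    using legal that by (rule next_pair_in_pairs)
  have q': "e \<in> pairs {..<n}" if "q' x h = Some e" for x h e
    using q[of h e] that by (auto simp: q'_def stop_after_def split: if_splits)
  have agree: "same (outlier_label m (l, x)) e = same (base_label m l) e"
    if "l \<in> ?L" "x \<in> ?U" and e: "e \<in> pairs {..<n} - D x l (l x)" for l x e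
  proof (cases "x \<in> e")
    case False
    then have "outlier_label m (l, x) y = base_label m l y" if "y \<in> e" for y
      using that by (auto simp: outlier_label_def)
    then show ?thesis
      by (simp add: same_def)
  next
    case True
    then obtain z where z: "e = {x, z}" "x \<noteq> z" "z < n"
      using e by (auto simp: pairs_def)
    then have "e - {x} = {z}"
      by auto
    then have "base_label m l z \<noteq> l x"
      using e z by (auto simp: D_def)
    moreover have "base_label m l z \<noteq> m"
      using base_label_less[OF that(1) z(3)] by simp
    moreover have "base_label m l x = l x"
      using that(2) by (simp add: base_label_def)
    ultimately show ?thesis
      using z(1,2) by (auto simp: same_def outlier_label_def)
  qed
  have step: "pr (same (outlier_label m (l, x))) (?sol (l, x))
      \<le> pr (same (base_label m l)) (G x) + (1 - 2 * \<delta>) * sqrt b' + R x l"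
    if l: "l \<in> ?L" and x: "x \<in> ?U" for l x
  proof -
    define ex where "ex = (\<lambda>h. ?q h \<in> Some ` T x \<and> b \<le> cnt ?q (T x) h)"
    have stop: "run (q' x) a B [] = run ?q a B [] \<and> \<not> ex (run ?q a B [])
        \<or> ex (run (q' x) a B []) \<and> b < cnt ?q (T x) (run ?q a (Suc B) [])" for a
      unfolding q'_def ex_def by (rule run_stop_after)
    \<comment> \<open>A forced stop counts as acceptance, so \<open>?\<Phi>\<close> holds of the
      stopped run whenever the original one solves the outlier world.\<close>
    let ?\<Phi> = "\<lambda>h. ex h \<or> ?ch x h"
    have "pr (same (outlier_label m (l, x))) (?sol (l, x))
        \<le> pr (same (outlier_label m (l, x))) (\<lambda>a. ?\<Phi> (run (q' x) a B []))"
    proof (rule pr_mono)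
      fix a assume "?sol (l, x) a"
      then have "?ch x (run ?q a B [])"
        using l x by (intro solved_imp_outlier_chosen) auto
      then show "?\<Phi> (run (q' x) a B [])"
        using stop[of a] by auto
    qed
    also have "\<dots> \<le> pr (same (base_label m l)) (\<lambda>a. ?\<Phi> (run (q' x) a B []))
        + (1 - 2 * \<delta>) * sqrt b' + R x l"
      unfolding R_def by (rule pr_run_le[OF q' agree[OF l x]])
    also have "pr (same (base_label m l)) (\<lambda>a. ?\<Phi> (run (q' x) a B [])) \<le> pr (same (base_label m l)) (G x)"
    proof (rule pr_mono)
      fix a assume "?\<Phi> (run (q' x) a B [])"
      then show "G x a"
        using stop[of a] by (auto simp: G_def simp del: run.simps)
    qed
    finally show ?thesis
      by simp
  qed
  have sum_G: "(\<Sum>x\<in>?U. pr \<theta> (G x)) \<le> Suc m + 2 * Suc B / Suc b" for \<theta>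
  proof (rule sum_pr_le)
    fix a
    let ?h = "run ?q a (Suc B) []"
    have "(\<Sum>x\<in>?U. of_bool (G x a)) \<le> (\<Sum>x\<in>?U. of_bool (?ch x (run ?q a B [])) + cnt ?q (T x) ?h / Suc b)"
      by (intro sum_mono) (auto simp: G_def divide_simps)
    also have "\<dots> = (\<Sum>x\<in>?U. of_bool (?ch x (run ?q a B []))) + real (\<Sum>x\<in>?U. cnt ?q (T x) ?h) / Suc b"
      by (simp add: sum.distrib sum_divide_distrib)
    also have "\<dots> \<le> Suc m + real (2 * Suc B) / Suc b"
    proof (intro add_mono divide_right_mono)
      have "(\<Sum>x\<in>?U. cnt ?q (T x) ?h) \<le> 2 * length ?h"
        unfolding T_def by (rule sum_cnt_touching_le[OF q]) auto
      also have "\<dots> \<le> 2 * Suc B"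
        using length_run[of ?q a "Suc B" "[]"] by simp
      finally show "real (\<Sum>x\<in>?U. cnt ?q (T x) ?h) \<le> real (2 * Suc B)"
        by (rule of_nat_mono)
      show "(\<Sum>x\<in>?U. of_bool (?ch x (run ?q a B []))) \<le> real (Suc m)"
        by (rule card_chosen_le) auto
    qed simp
    finally show "(\<Sum>x\<in>?U. of_bool (G x a)) \<le> Suc m + 2 * Suc B / Suc b"
      by simp
  qed
  have sum_R: "(\<Sum>l\<in>?L. R x l) \<le> card ?L * (b / (Suc b' * m))" if x: "x \<in> ?U" for x
  proof -
    have inner: "(\<Sum>j<m. R x (l(x := j))) \<le> b / Suc b'" for l
    proof -
      \<comment> \<open>Changing \<open>l x\<close> leaves the outlier world as it is and only
        selects another of the \<open>m\<close> disjoint sets \<open>D x l j\<close>, among which at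
        most \<open>b\<close> queries at \<open>x\<close> are divided.\<close>
      have "same (outlier_label m (l(x := j), x)) = same (outlier_label m (l, x))" for j
        by (rule arg_cong[where f = same]) (auto simp: outlier_label_def base_label_def)
      moreover have "D x (l(x := j)) j = D x l j" for j
        unfolding D_def by (intro Collect_cong conj_cong refl arg_cong2[where f = "(=)"] image_cong)
          (auto simp: base_label_def)
      ultimately have "(\<Sum>j<m. R x (l(x := j)))
          = (\<Sum>j<m. pr (same (outlier_label m (l, x))) (\<lambda>a. b' < cnt (q' x) (D x l j) (run (q' x) a B [])))"
        by (simp add: R_def)
      also have "\<dots> \<le> b / Suc b'"
      proof (rule sum_pr_cnt_le)
        show "disjoint_family_on (D x l) {..<m}"
          by (auto simp: disjoint_family_on_def D_def)
        have "(\<Union>j<m. D x l j) \<subseteq> T x"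
          by (auto simp: D_def T_def)
        then show "cnt (q' x) (\<Union>j<m. D x l j) (run (q' x) a B []) \<le> b" for a
          using order.trans[OF cnt_mono cnt_stop_after_le] by (auto simp: q'_def)
      qed simp
      finally show ?thesis .
    qed
    have "m * (\<Sum>l\<in>?L. R x l) = (\<Sum>l\<in>?L. \<Sum>j<m. R x (l(x := j)))"
      by (rule sum_labellings_resample[OF x, symmetric])
    also have "\<dots> \<le> (\<Sum>l\<in>?L. b / Suc b')"
      by (intro sum_mono inner)
    finally have "(\<Sum>l\<in>?L. R x l) \<le> card ?L * (b / Suc b') / m"
      using \<open>0 < m\<close> by (subst pos_le_divide_eq) (simp_all add: mult.commute)
    then show ?thesis
      by (simp only: of_nat_mult times_divide_eq_right divide_divide_eq_left)
  qed
  have "(\<Sum>i\<in>?L \<times> ?U. pr (same (outlier_label m i)) (?sol i))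
      = (\<Sum>l\<in>?L. \<Sum>x\<in>?U. pr (same (outlier_label m (l, x))) (?sol (l, x)))"
    by (simp add: sum.cartesian_product)
  also have "\<dots> \<le> (\<Sum>l\<in>?L. \<Sum>x\<in>?U. pr (same (base_label m l)) (G x) + (1 - 2 * \<delta>) * sqrt b' + R x l)"
    by (intro sum_mono step)
  also have "\<dots> = (\<Sum>l\<in>?L. \<Sum>x\<in>?U. pr (same (base_label m l)) (G x))
      + card ?L * ((n - m) * ((1 - 2 * \<delta>) * sqrt b')) + (\<Sum>x\<in>?U. \<Sum>l\<in>?L. R x l)"
    using sum.swap[of R ?L ?U] by (simp add: sum.distrib)
  also have "\<dots> \<le> (\<Sum>l\<in>?L. Suc m + 2 * Suc B / Suc b)
      + card ?L * ((n - m) * ((1 - 2 * \<delta>) * sqrt b')) + (\<Sum>x\<in>?U. card ?L * (b / (Suc b' * m)))"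
    by (intro add_mono order.refl sum_mono sum_G sum_R)
  also have "\<dots> = card ?L * (Suc m + 2 * Suc B / Suc b
        + (n - m) * ((1 - 2 * \<delta>) * sqrt b' + b / (Suc b' * m)))"
    by (simp add: algebra_simps)
  finally show ?thesis .
qed

section \<open>The lower bound\<close>

lemma nat_floor_bounds:
  fixes r :: real
  assumes "0 \<le> r"
  shows "nat \<lfloor>r\<rfloor> \<le> r" "r \<le> Suc (nat \<lfloor>r\<rfloor>)"
  using assms by linarith+

text \<open>\<open>l\<close> is the admissible loss in distinguishing two worlds; the budget is the
  largest integer whose loss, \<open>s\<close> times its square root, stays within
  \<open>l\<close>.\<close>

lemma noise_scale:
  fixes s l :: real
  assumes "0 < s" "0 < l"
  shows "s * sqrt (nat \<lfloor>l\<^sup>2 / s\<^sup>2\<rfloor>) \<le> l" "l\<^sup>2 / s\<^sup>2 \<le> Suc (nat \<lfloor>l\<^sup>2 / s\<^sup>2\<rfloor>)"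
proof -
  have "sqrt (nat \<lfloor>l\<^sup>2 / s\<^sup>2\<rfloor>) \<le> sqrt (l\<^sup>2 / s\<^sup>2)"
    using nat_floor_bounds[of "l\<^sup>2 / s\<^sup>2"] by simp
  also have "\<dots> = l / s"
    using assms by (simp add: real_sqrt_divide)
  finally show "s * sqrt (nat \<lfloor>l\<^sup>2 / s\<^sup>2\<rfloor>) \<le> l"
    using assms by (simp add: field_simps)
  show "l\<^sup>2 / s\<^sup>2 \<le> Suc (nat \<lfloor>l\<^sup>2 / s\<^sup>2\<rfloor>)"
    by (rule nat_floor_bounds) simp
qed

lemma small_distance:
  fixes c :: real and n :: nat
  assumes "1 \<le> c" "0 < n"
  obtains \<epsilon> :: real where "0 < \<epsilon>" "\<epsilon> \<le> 1" "c * card {..<n} * \<epsilon> < 1"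
proof
  let ?\<epsilon> = "1 / (2 * c * n)"
  have "1 \<le> c * n"
    using assms mult_mono[of 1 c 1 "real n"] by simp
  then show "0 < ?\<epsilon>" "?\<epsilon> \<le> 1" "c * card {..<n} * ?\<epsilon> < 1"
    using assms by (auto simp: field_simps)
qed

lemma expected_queries_many_clusters:
  fixes n k :: nat and c \<delta> :: real
  assumes "1 \<le> c" "2 \<le> k" "k < n" "n \<le> 8 * k" "0 < \<delta>" "\<delta> < 1/2"
    and alg: "randomized_algorithm {..<n} M A"
    and success: "\<And>d g. Metric_space {..<n} d \<Longrightarrow> 3/4 \<le> success_prob c {..<n} k \<delta> d g M A"
  shows "\<exists>d g. Metric_space {..<n} d \<and>
    ennreal (1 / 10^8 * (real n * real k / (1 - 2*\<delta>)\<^sup>2)) \<le> expected_queries {..<n} \<delta> d g M A"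
proof -
  define s where "s = 1 - 2 * \<delta>"
  define p where "p = real (card (merge_index k))"
  define b where "b = nat \<lfloor>(1/36)\<^sup>2 / s\<^sup>2\<rfloor>"
  \<comment> \<open>\<open>46656 = 36^3\<close>: as \<open>Suc b\<close> is at least
    \<open>(1/36)\<^sup>2 / s\<^sup>2\<close>, this makes \<open>B / Suc b\<close> at most
    \<open>p / 36\<close>.\<close>
  define B where "B = nat \<lfloor>p / 46656 / s\<^sup>2\<rfloor>"
  have s: "0 < s"
    using assms by (simp add: s_def)
  have p: "2 * p = real k * (real k + 1)"
  proof -
    have "real (2 * card (merge_index k)) = real (k * Suc k)"
      by (simp only: card_merge_index)
    then show ?thesis
      by (simp add: p_def algebra_simps)
  qed
  have "0 < p"
  proof -
    have "0 < real k * (real k + 1)"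
      using assms(2) by (intro mult_pos_pos) auto
    then show ?thesis
      using p by linarith
  qed
  have b: "s * sqrt b \<le> 1/36" "(1/36)\<^sup>2 / s\<^sup>2 \<le> Suc b"
    unfolding b_def by (rule noise_scale[OF s]; simp)+
  have B: "B \<le> p / 46656 / s\<^sup>2" "p / 46656 / s\<^sup>2 \<le> Suc B"
    unfolding B_def using \<open>0 < p\<close> by (intro nat_floor_bounds; simp)+
  have "B / Suc b \<le> (p / 46656 / s\<^sup>2) / ((1/36)\<^sup>2 / s\<^sup>2)"
    using B(1) b(2) s \<open>0 < p\<close> by (intro frac_le) auto
  also have "\<dots> = p / 36"
    using s by (simp add: power2_eq_square)
  finally have Bb: "B / Suc b \<le> p / 36" .
  obtain \<epsilon> :: real where \<epsilon>: "0 < \<epsilon>" "\<epsilon> \<le> 1" "c * card {..<n} * \<epsilon> < 1"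
    using small_distance[OF assms(1), of n] assms(2,3) by auto
  have "\<exists>i\<in>merge_index k. ennreal (1/36 * Suc B) \<le> expected_queries {..<n} \<delta>
      (cluster_dist \<epsilon> (merge_cluster k i)) (flipped_dist \<epsilon> (merge_cluster k i)) M A"
  proof (rule expected_queries_ge[OF alg _ assms(5,6) \<epsilon> assms(1) finite_merge_index])
    show "merge_index k \<noteq> {}"
      using \<open>0 < p\<close> by (auto simp: p_def)
    show "card (merge_cluster k i ` {..<n}) = k" if "i \<in> merge_index k" for i
      using card_merge_cluster_image[OF assms(3) that] .
    show "3/4 \<le> success_prob c {..<n} k \<delta> (cluster_dist \<epsilon> (merge_cluster k i)) (flipped_dist \<epsilon> (merge_cluster k i)) M A" for i
      by (intro success Metric_space_cluster_dist \<epsilon>)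
    fix S :: "nat strategy" assume legal: "\<And>h. S h \<in> legal_actions {..<n}"
    \<comment> \<open>The shares \<open>2/3\<close>, \<open>1/36\<close> and \<open>1/36\<close> add
      up to \<open>3/4 - 1/36\<close>. The first uses \<open>2 \<le> k\<close>, as
      \<open>p = k * (k + 1) / 2\<close>.\<close>
    have "k + p * (s * sqrt b) + B / Suc b \<le> p * (2/3) + p * (1/36) + p / 36"
    proof (intro add_mono mult_left_mono b Bb)
      have "real k * 3 \<le> real k * (real k + 1)"
        using assms(2) by (intro mult_left_mono) auto
      then show "k \<le> p * (2/3)"
        using p by linarith
    qed (use \<open>0 < p\<close> in auto)
    also have "\<dots> = p * (3/4 - 1/36)"
      by simp
    finally show "(\<Sum>i\<in>merge_index k. noisy_bits.pr (pairs {..<n}) \<delta> (same (merge_cluster k i))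
         (\<lambda>a. solved \<epsilon> {..<n} k (merge_cluster k i) S (run (next_pair \<epsilon> S) a B [])))
         \<le> card (merge_index k) * (3/4 - 1/36)"
      using sum_pr_merge_le[where b = b and B = B and \<epsilon> = \<epsilon> and S = S, OF assms(3,5,6) legal]
      unfolding p_def s_def by linarith
  qed (use assms in auto)
  then obtain i where i: "ennreal (1/36 * Suc B) \<le> expected_queries {..<n} \<delta>
      (cluster_dist \<epsilon> (merge_cluster k i)) (flipped_dist \<epsilon> (merge_cluster k i)) M A"
    by blast
  \<comment> \<open>Here \<open>n \<le> 8 * k\<close> turns a bound of order
    \<open>k\<^sup>2\<close> into one of order \<open>n * k\<close>.\<close>
  have "real n * real k \<le> 8 * real k * real k"
    using assms(4) by (intro mult_right_mono) (auto simp flip: of_nat_mult)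
  also have "\<dots> \<le> 16 * p"
    using p by (simp add: algebra_simps)
  finally have "real n * real k \<le> 16 * p" .
  moreover have "1 / 10^8 * y \<le> 1/36 * (z / 46656)" if "y \<le> 16 * z" "0 < z" for y z :: real
    using that by simp
  ultimately have "1 / 10^8 * (real n * real k) \<le> 1/36 * (p / 46656)"
    using \<open>0 < p\<close> by blast
  then have "1 / 10^8 * (real n * real k) / s\<^sup>2 \<le> 1/36 * (p / 46656) / s\<^sup>2"
    by (rule divide_right_mono) simp
  then have "1 / 10^8 * (real n * real k / s\<^sup>2) \<le> 1/36 * (p / 46656 / s\<^sup>2)"
    by simp
  also have "\<dots> \<le> 1/36 * Suc B"
    using B(2) by simp
  finally show ?thesis
    using i order.trans[OF ennreal_leI i] Metric_space_cluster_dist[OF \<epsilon>(1,2)] unfolding s_def by blast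
qed

lemma expected_queries_few_clusters:
  fixes n k :: nat and c \<delta> :: real
  assumes "1 \<le> c" "2 \<le> k" "8 * k < n" "0 < \<delta>" "\<delta> < 1/2"
    and alg: "randomized_algorithm {..<n} M A"
    and success: "\<And>d g. Metric_space {..<n} d \<Longrightarrow> 3/4 \<le> success_prob c {..<n} k \<delta> d g M A"
  shows "\<exists>d g. Metric_space {..<n} d \<and>
    ennreal (1 / 10^8 * (real n * real k / (1 - 2*\<delta>)\<^sup>2)) \<le> expected_queries {..<n} \<delta> d g M A"
proof -
  define s where "s = 1 - 2 * \<delta>"
  define m where "m = k - 1"
  define u where "u = real (n - m)"
  \<comment> \<open>\<open>b'\<close> allows a distinguishing loss of \<open>1/8\<close>. Since
    \<open>512 = 8 * 64\<close>, the average overflow \<open>b / (Suc b' * m)\<close> is at most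
    \<open>1/8\<close>, and \<open>8192 = 16 * 512\<close> makes \<open>B / Suc b\<close> at most
    \<open>u / 16\<close>.\<close>
  define b' where "b' = nat \<lfloor>(1/8)\<^sup>2 / s\<^sup>2\<rfloor>"
  define b where "b = nat \<lfloor>m / 512 / s\<^sup>2\<rfloor>"
  define B where "B = nat \<lfloor>u * m / 8192 / s\<^sup>2\<rfloor>"
  have m: "0 < m" "m < n" "k = Suc m"
    using assms(2,3) by (auto simp: m_def)
  have s: "0 < s"
    using assms by (simp add: s_def)
  have u: "u = real n - real m" "7 * k \<le> u" "14 \<le> u" "7 * n \<le> 8 * u"
    using assms(2,3) m by (auto simp: u_def of_nat_diff)
  have b': "s * sqrt b' \<le> 1/8" "(1/8)\<^sup>2 / s\<^sup>2 \<le> Suc b'"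
    unfolding b'_def by (rule noise_scale[OF s]; simp)+
  have b: "b \<le> m / 512 / s\<^sup>2" "m / 512 / s\<^sup>2 \<le> Suc b"
    unfolding b_def by (intro nat_floor_bounds; simp)+
  have B: "B \<le> u * m / 8192 / s\<^sup>2" "u * m / 8192 / s\<^sup>2 \<le> Suc B"
    unfolding B_def using u(3) by (intro nat_floor_bounds; simp)+
  have "b / (Suc b' * m) \<le> (m / 512 / s\<^sup>2) / ((1/8)\<^sup>2 / s\<^sup>2 * m)"
    using b(1) b'(2) s m(1) unfolding of_nat_mult by (intro frac_le mult_right_mono) auto
  also have "\<dots> = 1/8"
    using s m(1) by (simp add: power2_eq_square)
  finally have bb': "b / (Suc b' * m) \<le> 1/8" .
  have "B / Suc b \<le> (u * m / 8192 / s\<^sup>2) / (m / 512 / s\<^sup>2)"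
    using B(1) b(2) s m(1) u(3) by (intro frac_le) auto
  also have "\<dots> = u / 16"
    using s m(1) by simp
  finally have "B / Suc b \<le> u / 16" .
  moreover have "1 / Suc b \<le> 1"
    by simp
  moreover have "2 * Suc B / Suc b = 2 * (B / Suc b) + 2 * (1 / Suc b)"
    by (simp add: add_divide_distrib)
  \<comment> \<open>The extra \<open>u / 7\<close> absorbs the rounding term
    \<open>2 / Suc b\<close>, as \<open>14 \<le> u\<close>.\<close>
  ultimately have Bb: "2 * Suc B / Suc b \<le> u / 8 + u / 7"
    using u(3) by linarith
  obtain \<epsilon> :: real where \<epsilon>: "0 < \<epsilon>" "\<epsilon> \<le> 1" "c * card {..<n} * \<epsilon> < 1"
    using small_distance[OF assms(1), of n] assms(2,3) by auto
  let ?I = "labellings m n \<times> {m..<n}"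
  have "\<exists>i\<in>?I. ennreal (1/12 * Suc B) \<le> expected_queries {..<n} \<delta>
      (cluster_dist \<epsilon> (outlier_label m i)) (flipped_dist \<epsilon> (outlier_label m i)) M A"
  proof (rule expected_queries_ge[OF alg _ assms(4,5) \<epsilon> assms(1)])
    show "finite ?I"
      using finite_labellings by auto
    show "?I \<noteq> {}"
      using labellings_nonempty[OF m(1)] m(2) by auto
    show "card (outlier_label m i ` {..<n}) = k" if "i \<in> ?I" for i
      using that card_outlier_label_image m(3) by (cases i) auto
    show "3/4 \<le> success_prob c {..<n} k \<delta> (cluster_dist \<epsilon> (outlier_label m i)) (flipped_dist \<epsilon> (outlier_label m i)) M A" for i
      by (intro success Metric_space_cluster_dist \<epsilon>)
    fix S :: "nat strategy" assume legal: "\<And>h. S h \<in> legal_actions {..<n}"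
    \<comment> \<open>The shares of \<open>u\<close> add up to \<open>2/7 + 3/8 = 37/56\<close>,
      which is below \<open>2/3 = 3/4 - 1/12\<close>.\<close>
    have "Suc m + 2 * Suc B / Suc b + u * (s * sqrt b' + b / (Suc b' * m))
        \<le> u / 7 + (u / 8 + u / 7) + u * (1/8 + 1/8)"
    proof (intro add_mono mult_left_mono b' bb' Bb)
      show "Suc m \<le> u / 7"
        using u(2) m(3) by simp
    qed (use u(3) in auto)
    also have "\<dots> \<le> u * (3/4 - 1/12)"
      using u(3) by simp
    finally have "card (labellings m n) * (Suc m + 2 * Suc B / Suc b + u * (s * sqrt b' + b / (Suc b' * m)))
        \<le> card (labellings m n) * (u * (3/4 - 1/12))"
      by (rule mult_left_mono) simp
    also have "\<dots> = card ?I * (3/4 - 1/12)"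
      by (simp add: card_cartesian_product u_def)
    finally show "(\<Sum>i\<in>?I. noisy_bits.pr (pairs {..<n}) \<delta> (same (outlier_label m i))
         (\<lambda>a. solved \<epsilon> {..<n} k (outlier_label m i) S (run (next_pair \<epsilon> S) a B [])))
         \<le> card ?I * (3/4 - 1/12)"
      using sum_pr_outlier_le[where b = b and b' = b' and B = B and \<epsilon> = \<epsilon> and S = S, OF m(1,2) assms(4,5) legal]
      unfolding m(3) s_def u_def by linarith
  qed (use assms in auto)
  then obtain i where i: "ennreal (1/12 * Suc B) \<le> expected_queries {..<n} \<delta>
      (cluster_dist \<epsilon> (outlier_label m i)) (flipped_dist \<epsilon> (outlier_label m i)) M A"
    by blast
  have "real n * real k \<le> (8/7 * u) * (2 * real m)"
    using u(3,4) m by (intro mult_mono) auto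
  then have "real n * real k \<le> 16/7 * (u * m)"
    by simp
  moreover have "0 \<le> u * m"
    using u(3) by simp
  moreover have "1 / 10^8 * y \<le> 1/12 * (z / 8192)" if "y \<le> 16/7 * z" "0 \<le> z" for y z :: real
    using that by simp
  ultimately have "1 / 10^8 * (real n * real k) \<le> 1/12 * (u * m / 8192)"
    by blast
  then have "1 / 10^8 * (real n * real k) / s\<^sup>2 \<le> 1/12 * (u * m / 8192) / s\<^sup>2"
    by (rule divide_right_mono) simp
  then have "1 / 10^8 * (real n * real k / s\<^sup>2) \<le> 1/12 * (u * m / 8192 / s\<^sup>2)"
    by simp
  also have "\<dots> \<le> 1/12 * Suc B"
    using B(2) by simp
  finally show ?thesis
    using i order.trans[OF ennreal_leI i] Metric_space_cluster_dist[OF \<epsilon>(1,2)] unfolding s_def by blast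
qed

theorem theorem12:
  fixes c :: real
  assumes "c \<ge> 1"
  shows "\<exists>K>0. \<forall>(n::nat) (k::nat) (\<delta>::real) (M :: tape measure) (A :: tape \<Rightarrow> nat strategy).
    2 \<le> k \<and> k < n \<and> 0 < \<delta> \<and> \<delta> < 1/2 \<and>
    randomized_algorithm {..<n} M A \<and>
    (\<forall>d g. Metric_space {..<n} d \<longrightarrow> success_prob c {..<n} k \<delta> d g M A \<ge> 3/4)
    \<longrightarrow> (\<exists>d g. Metric_space {..<n} d \<and>
           expected_queries {..<n} \<delta> d g M A \<ge> ennreal (K * (real n * real k / (1 - 2*\<delta>)^2)))"
\<comment> \<open>The constant is the same for every \<open>c\<close>, which enters only through the
  choice of \<open>\<epsilon>\<close>.\<close>
proof (intro exI[of _ "1 / 10^8"] conjI allI impI; (elim conjE)?)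
  fix n k :: nat and \<delta> :: real and M :: "tape measure" and A :: "tape \<Rightarrow> nat strategy"
  assume "2 \<le> k" "k < n" "0 < \<delta>" "\<delta> < 1/2" "randomized_algorithm {..<n} M A"
    "\<forall>d g. Metric_space {..<n} d \<longrightarrow> success_prob c {..<n} k \<delta> d g M A \<ge> 3/4"
  then show "\<exists>d g. Metric_space {..<n} d \<and>
      ennreal (1 / 10^8 * (real n * real k / (1 - 2*\<delta>)^2)) \<le> expected_queries {..<n} \<delta> d g M A"
    using expected_queries_many_clusters[OF assms, of k n \<delta> M A]
      expected_queries_few_clusters[OF assms, of k n \<delta> M A]
    by (cases "n \<le> 8 * k") auto
qed simp

end
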